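(* Let $\pi=(p_0,p_1,\dots)$ be a sequence of exponents in $[1,\infty]$. Let $f:X\to X'$ be a coarse embedding between metric spaces. Then for every $R>0$, $R\le S<\infty$ and $\ell'\ge1$, there exist $R'>0$, $S'<\infty$ and $\ell\ge1$ such that $f$ induces a multiplicative morphism $$f^*:L^\pi_{\ell',R',S'}H^\cdot(X')\to L^\pi_{\ell,R,S}H^\cdot(X).$$ If $g:X\to X'$ satisfies $\sup_{x\in X}d(f(x),g(x))<+\infty$, then $g$ is a coarse embedding as well, and $f^*=g^*$.
   Context: A map $f:X\to X'$ between metric spaces is a coarse embedding if for every $T>0$ there exists $T'(T)>0$ such that for every $T$-ball $B$ of $X$ and every $T$-ball $B'$ of $X'$, $f(B)$ and $f^{-1}(B')$ are contained in $T'$-balls. **Packing cohomology.** For a metric space $X$, the Rips complex of size $S$ has vertex set $X$; $k+1$ distinct points span a $k$-simplex iff they are contained in some ball of radius $S$. Its simplicial cochains (skew-symmetric, extended by $0$ to degenerate tuples) are called Alexander-Spanier cochains of size $S$, with simplicial coboundary $d$. For $\ell\ge1$, $0<R\le S<\infty$, an $(\ell,R,S)$-packing is a collection of balls $B_j$ with radii in $[R,S]$ such that the concentric balls $\ell B_j$ are pairwise disjoint. The packing norm of a $k$-cochain $\kappa$ of size $S$ is $$\|\kappa\|_{p,\ell,R,S}=\sup_{(\ell,R,S)\text{-packings }\{B_j\}}\Big(\sum_j\sup_{x_0,\dots,x_k\in B_j}|\kappa(x_0,\dots,x_k)|^p\Big)^{1/p}$$ (supremum if $p=\infty$), defining the Banach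 space $AL^{p,k}_{\ell,R,S}(X)$. The spaces $AL^{\pi,k}_{\ell,R,S}(X)=AL^{p_k,k}_{\ell,R,S}(X)\cap d^{-1}(AL^{p_{k+1},k+1}_{\ell,R,S}(X))$ form a complex of Banach spaces, whose cohomology, denoted $L^\pi_{\ell,R,S}H^\cdot(X)$, is the packing $\ell^\pi$-cohomology. The morphism induced by $f$ is given by composition of cochains with $f$. "Multiplicative" means compatible with the cup-products induced by the cup-product of cochains, defined from degree $k$ (exponents $(q,p)=(p_{k-1},p_k)$) and degree $k'$ (exponents $(q',p')$) to degree $k+k'$ (exponents $(q'',p'')$) whenever $\frac1p+\frac1{p'}=\frac1{p''}$ and $\frac1p+\frac1{q'}=\frac1{q''}=\frac1{p'}+\frac1q$.
   Formalization: The equality f^*=g^* is asserted only in degree 0 and in degrees k with p_k ≤ p_{k-1}; otherwise it can fail, e.g. on the real line in degree 1 with f the identity, g(x)=x+1, p_0=1, p_1=∞. *)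

theory Defs
  imports "HOL-Analysis.Analysis"
begin

definition coarse_embedding :: "('a::metric_space \<Rightarrow> 'b::metric_space) \<Rightarrow> bool" where
  "coarse_embedding f \<longleftrightarrow>
     (\<forall>T>0. \<exists>T'>0. (\<forall>x. \<exists>y. f ` ball x T \<subseteq> ball y T') \<and>
                   (\<forall>y. \<exists>x. f -` ball y T \<subseteq> ball x T'))"

text \<open>Tuples of points are lists. A list is an \<^emph>\<open>ordered\<close> \<open>k\<close>-simplex of the Rips complex of
  size \<open>S\<close> if its \<open>k + 1\<close> entries are distinct and lie in a common ball of radius \<open>S\<close>.\<close>

definition rips_simplex :: "real \<Rightarrow> nat \<Rightarrow> 'a::metric_space list \<Rightarrow> bool" where
  "rips_simplex S k xs \<longleftrightarrow>
     length xs = Suc k \<and> distinct xs \<and> (\<exists>c. set xs \<subseteq> ball c S)"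

text \<open>Cochains are real-valued and vanish on every list that is not an ordered simplex. On
  degenerate tuples this is the prescribed extension by \<open>0\<close>; on the remaining lists it is a
  convention that makes a cochain determined by its values on simplices.\<close>

type_synonym 'a cochain = "'a list \<Rightarrow> real"

definition AS_cochains :: "real \<Rightarrow> nat \<Rightarrow> 'a::metric_space cochain set" where
  "AS_cochains S k = {\<kappa>.
     (\<forall>xs. \<not> rips_simplex S k xs \<longrightarrow> \<kappa> xs = 0) \<and>
     (\<forall>xs \<sigma>. length xs = Suc k \<longrightarrow> \<sigma> permutes {..<Suc k} \<longrightarrow>
        \<kappa> (permute_list \<sigma> xs) = of_int (sign \<sigma>) * \<kappa> xs)}"

text \<open>The coboundary of a \<open>k\<close>-cochain; \<open>take i xs @ drop (Suc i) xs\<close> omits the \<open>i\<close>-th vertex.\<close>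

definition coboundary :: "real \<Rightarrow> nat \<Rightarrow> 'a::metric_space cochain \<Rightarrow> 'a cochain" where
  "coboundary S k \<kappa> = (\<lambda>xs. if rips_simplex S (Suc k) xs
     then (\<Sum>i\<le>Suc k. (-1) ^ i * \<kappa> (take i xs @ drop (Suc i) xs)) else 0)"

text \<open>A ball is given by its centre and radius. For \<open>l \<ge> 1\<close> and \<open>R > 0\<close> the dilated balls are
  nonempty, so a packing never repeats a ball and can be represented by a set.\<close>

definition packings :: "real \<Rightarrow> real \<Rightarrow> real \<Rightarrow> ('a::metric_space \<times> real) set set" where
  "packings l R S = {P.
     (\<forall>(c, r)\<in>P. R \<le> r \<and> r \<le> S) \<and>
     pairwise (\<lambda>(c, r) (c', r'). disjnt (ball c (l * r)) (ball c' (l * r'))) P}"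

definition ennreal_powr :: "ennreal \<Rightarrow> real \<Rightarrow> ennreal" where
  "ennreal_powr x a = (if x = \<infinity> then \<infinity> else ennreal (enn2real x powr a))"

definition packing_norm ::
  "ennreal \<Rightarrow> real \<Rightarrow> real \<Rightarrow> real \<Rightarrow> nat \<Rightarrow> 'a::metric_space cochain \<Rightarrow> ennreal" where
  "packing_norm p l R S k \<kappa> =
     (if p = \<infinity> then
        (SUP P\<in>packings l R S. SUP (c, r)\<in>P.
           SUP xs\<in>{xs. length xs = Suc k \<and> set xs \<subseteq> ball c r}. ennreal \<bar>\<kappa> xs\<bar>)
      else
        (SUP P\<in>packings l R S.
           ennreal_powr
             (\<Sum>\<^sub>\<infinity>(c, r)\<in>P.
                SUP xs\<in>{xs. length xs = Suc k \<and> set xs \<subseteq> ball c r}. ennreal (\<bar>\<kappa> xs\<bar> powr enn2real p))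
             (1 / enn2real p)))"

definition AL_space ::
  "ennreal \<Rightarrow> real \<Rightarrow> real \<Rightarrow> real \<Rightarrow> nat \<Rightarrow> 'a::metric_space cochain set" where
  "AL_space p l R S k = {\<kappa> \<in> AS_cochains S k. packing_norm p l R S k \<kappa> < \<infinity>}"

definition AL_complex ::
  "(nat \<Rightarrow> ennreal) \<Rightarrow> real \<Rightarrow> real \<Rightarrow> real \<Rightarrow> nat \<Rightarrow> 'a::metric_space cochain set" where
  "AL_complex \<pi> l R S k =
     {\<kappa> \<in> AL_space (\<pi> k) l R S k. coboundary S k \<kappa> \<in> AL_space (\<pi> (Suc k)) l R S (Suc k)}"

definition AL_cocycles ::
  "(nat \<Rightarrow> ennreal) \<Rightarrow> real \<Rightarrow> real \<Rightarrow> real \<Rightarrow> nat \<Rightarrow> 'a::metric_space cochain set" where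
  "AL_cocycles \<pi> l R S k = {\<kappa> \<in> AL_complex \<pi> l R S k. coboundary S k \<kappa> = (\<lambda>_. 0)}"

fun AL_coboundaries ::
  "(nat \<Rightarrow> ennreal) \<Rightarrow> real \<Rightarrow> real \<Rightarrow> real \<Rightarrow> nat \<Rightarrow> 'a::metric_space cochain set" where
  "AL_coboundaries \<pi> l R S 0 = {\<lambda>_. 0}"
| "AL_coboundaries \<pi> l R S (Suc k) = coboundary S k ` AL_complex \<pi> l R S k"

definition cohomologous ::
  "(nat \<Rightarrow> ennreal) \<Rightarrow> real \<Rightarrow> real \<Rightarrow> real \<Rightarrow> nat \<Rightarrow> ('a::metric_space cochain \<times> 'a cochain) set" where
  "cohomologous \<pi> l R S k =
     {(\<kappa>, \<mu>). \<kappa> \<in> AL_cocycles \<pi> l R S k \<and> \<mu> \<in> AL_cocycles \<pi> l R S k \<and>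
        (\<lambda>xs. \<kappa> xs - \<mu> xs) \<in> AL_coboundaries \<pi> l R S k}"

text \<open>Packing cohomology is the unreduced quotient, a set of classes of cocycles.\<close>

definition packing_cohomology ::
  "(nat \<Rightarrow> ennreal) \<Rightarrow> real \<Rightarrow> real \<Rightarrow> real \<Rightarrow> nat \<Rightarrow> 'a::metric_space cochain set set" where
  "packing_cohomology \<pi> l R S k = AL_cocycles \<pi> l R S k // cohomologous \<pi> l R S k"

text \<open>Operations on classes are unions, over all choices of representatives, of the class of the
  result; this is a single class exactly when the operation is well defined.\<close>

definition class_add ::
  "(nat \<Rightarrow> ennreal) \<Rightarrow> real \<Rightarrow> real \<Rightarrow> real \<Rightarrow> nat \<Rightarrow>
   'a::metric_space cochain set \<Rightarrow> 'a cochain set \<Rightarrow> 'a cochain set" where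
  "class_add \<pi> l R S k A B =
     (\<Union>\<kappa>\<in>A. \<Union>\<mu>\<in>B. cohomologous \<pi> l R S k `` {\<lambda>xs. \<kappa> xs + \<mu> xs})"

definition class_scale ::
  "(nat \<Rightarrow> ennreal) \<Rightarrow> real \<Rightarrow> real \<Rightarrow> real \<Rightarrow> nat \<Rightarrow>
   real \<Rightarrow> 'a::metric_space cochain set \<Rightarrow> 'a cochain set" where
  "class_scale \<pi> l R S k a A = (\<Union>\<kappa>\<in>A. cohomologous \<pi> l R S k `` {\<lambda>xs. a * \<kappa> xs})"

text \<open>The front-face/back-face product is not skew-symmetric, so it is antisymmetrized over the
  vertices; antisymmetrization commutes with the coboundary.\<close>

definition cup_cochain ::
  "real \<Rightarrow> nat \<Rightarrow> nat \<Rightarrow> 'a::metric_space cochain \<Rightarrow> 'a cochain \<Rightarrow> 'a cochain" where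
  "cup_cochain S k k' \<kappa> \<mu> = (\<lambda>xs. if rips_simplex S (k + k') xs
     then (\<Sum>\<sigma> | \<sigma> permutes {..<Suc (k + k')}. of_int (sign \<sigma>) *
             (\<kappa> (take (Suc k) (permute_list \<sigma> xs)) * \<mu> (drop k (permute_list \<sigma> xs))))
          / fact (Suc (k + k'))
     else 0)"

text \<open>The target sequence \<open>\<pi>\<close> of exponents, with the degree \<open>k + k'\<close>, determines the space in
  which the product class is taken.\<close>

definition class_cup ::
  "(nat \<Rightarrow> ennreal) \<Rightarrow> real \<Rightarrow> real \<Rightarrow> real \<Rightarrow> nat \<Rightarrow> nat \<Rightarrow>
   'a::metric_space cochain set \<Rightarrow> 'a cochain set \<Rightarrow> 'a cochain set" where
  "class_cup \<pi> l R S k k' A B =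
     (\<Union>\<kappa>\<in>A. \<Union>\<mu>\<in>B. cohomologous \<pi> l R S (k + k') `` {cup_cochain S k k' \<kappa> \<mu>})"

definition exponents :: "(nat \<Rightarrow> ennreal) \<Rightarrow> bool" where
  "exponents \<pi> \<longleftrightarrow> (\<forall>k. 1 \<le> \<pi> k)"

text \<open>With \<open>(q, p) = (\<pi> (k - 1), \<pi> k)\<close>, and similarly for the primed pairs, these are the
  relations \<open>1/p + 1/p' = 1/p''\<close> and \<open>1/p + 1/q' = 1/q'' = 1/p' + 1/q\<close>, where \<open>1/\<infinity> = 0\<close>. In
  degree \<open>0\<close> there are no coboundaries and no exponent \<open>q\<close>; the relation involving it is dropped.\<close>

definition cup_exponents ::
  "(nat \<Rightarrow> ennreal) \<Rightarrow> nat \<Rightarrow> (nat \<Rightarrow> ennreal) \<Rightarrow> nat \<Rightarrow> (nat \<Rightarrow> ennreal) \<Rightarrow> bool" where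
  "cup_exponents \<pi> k \<pi>' k' \<pi>'' \<longleftrightarrow>
     inverse (\<pi> k) + inverse (\<pi>' k') = inverse (\<pi>'' (k + k')) \<and>
     (0 < k' \<longrightarrow> inverse (\<pi> k) + inverse (\<pi>' (k' - 1)) = inverse (\<pi>'' (k + k' - 1))) \<and>
     (0 < k \<longrightarrow> inverse (\<pi>' k') + inverse (\<pi> (k - 1)) = inverse (\<pi>'' (k + k' - 1)))"

text \<open>Composition of cochains with \<open>f\<close>, as a cochain of size \<open>S\<close> on the source.\<close>

definition pull_cochain ::
  "('a::metric_space \<Rightarrow> 'b::metric_space) \<Rightarrow> real \<Rightarrow> nat \<Rightarrow> 'b cochain \<Rightarrow> 'a cochain" where
  "pull_cochain f S k \<kappa> = (\<lambda>xs. if rips_simplex S k xs then \<kappa> (map f xs) else 0)"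

definition pull_class ::
  "('a::metric_space \<Rightarrow> 'b::metric_space) \<Rightarrow> (nat \<Rightarrow> ennreal) \<Rightarrow> real \<Rightarrow> real \<Rightarrow> real \<Rightarrow> nat \<Rightarrow>
   'b cochain set \<Rightarrow> 'a cochain set" where
  "pull_class f \<pi> l R S k A = (\<Union>\<kappa>\<in>A. cohomologous \<pi> l R S k `` {pull_cochain f S k \<kappa>})"

text \<open>\<open>f\<close> induces a morphism on packing cohomology: \<open>f\<close> maps tuples of size \<open>S\<close> to tuples of size
  \<open>S'\<close>, so that the composite of a cochain of size \<open>S'\<close> with \<open>f\<close> really is defined on all
  simplices of size \<open>S\<close>; composition with \<open>f\<close> is a bounded morphism of complexes; and the map it
  induces on classes is well defined and linear.\<close>

definition induces_morphism ::
  "('a::metric_space \<Rightarrow> 'b::metric_space) \<Rightarrow> (nat \<Rightarrow> ennreal) \<Rightarrow>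
   real \<Rightarrow> real \<Rightarrow> real \<Rightarrow> real \<Rightarrow> real \<Rightarrow> real \<Rightarrow> bool" where
  "induces_morphism f \<pi> l' R' S' l R S \<longleftrightarrow>
     (\<forall>V. finite V \<longrightarrow> (\<exists>c. V \<subseteq> ball c S) \<longrightarrow> (\<exists>c. f ` V \<subseteq> ball c S')) \<and>
     (\<forall>k. (\<forall>\<kappa> \<in> AL_complex \<pi> l' R' S' k.
             pull_cochain f S k \<kappa> \<in> AL_complex \<pi> l R S k \<and>
             coboundary S k (pull_cochain f S k \<kappa>) =
               pull_cochain f S (Suc k) (coboundary S' k \<kappa>)) \<and>
          (\<exists>C::real. \<forall>\<kappa> \<in> AL_space (\<pi> k) l' R' S' k.
             packing_norm (\<pi> k) l R S k (pull_cochain f S k \<kappa>)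
               \<le> ennreal C * packing_norm (\<pi> k) l' R' S' k \<kappa>) \<and>
          (\<forall>A \<in> packing_cohomology \<pi> l' R' S' k.
             pull_class f \<pi> l R S k A \<in> packing_cohomology \<pi> l R S k \<and>
             (\<forall>B \<in> packing_cohomology \<pi> l' R' S' k.
                pull_class f \<pi> l R S k (class_add \<pi> l' R' S' k A B) =
                class_add \<pi> l R S k (pull_class f \<pi> l R S k A) (pull_class f \<pi> l R S k B)) \<and>
             (\<forall>a. pull_class f \<pi> l R S k (class_scale \<pi> l' R' S' k a A) =
                class_scale \<pi> l R S k a (pull_class f \<pi> l R S k A))))"

text \<open>The second factor and the product live in packing cohomology with arbitrary sequences of
  exponents \<open>\<pi>'\<close> and \<open>\<pi>''\<close>, subject to the relations under which the cup-product is defined.\<close>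

definition is_multiplicative ::
  "('a::metric_space \<Rightarrow> 'b::metric_space) \<Rightarrow> (nat \<Rightarrow> ennreal) \<Rightarrow>
   real \<Rightarrow> real \<Rightarrow> real \<Rightarrow> real \<Rightarrow> real \<Rightarrow> real \<Rightarrow> bool" where
  "is_multiplicative f \<pi> l' R' S' l R S \<longleftrightarrow>
     (\<forall>\<pi>' \<pi>'' k k'. exponents \<pi>' \<longrightarrow> exponents \<pi>'' \<longrightarrow> cup_exponents \<pi> k \<pi>' k' \<pi>'' \<longrightarrow>
        (\<forall>A \<in> packing_cohomology \<pi> l' R' S' k. \<forall>B \<in> packing_cohomology \<pi>' l' R' S' k'.
           pull_class f \<pi>' l R S k' B \<in> packing_cohomology \<pi>' l R S k' \<and>
           class_cup \<pi>'' l' R' S' k k' A B \<in> packing_cohomology \<pi>'' l' R' S' (k + k') \<and>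
           pull_class f \<pi>'' l R S (k + k') (class_cup \<pi>'' l' R' S' k k' A B) =
             class_cup \<pi>'' l R S k k' (pull_class f \<pi> l R S k A) (pull_class f \<pi>' l R S k' B)))"

text \<open>For maps at bounded distance, the chain homotopy sends \<open>k\<close>-cochains of finite \<open>\<pi> k\<close>-norm to
  \<open>(k - 1)\<close>-cochains of finite \<open>\<pi> k\<close>-norm, and these have finite \<open>\<pi> (k - 1)\<close>-norm if
  \<open>\<pi> k \<le> \<pi> (k - 1)\<close>. Without this inequality the induced maps can differ: on the real line with
  \<open>\<pi> 0 = 1\<close> and \<open>\<pi> 1 = \<infinity>\<close>, the identity and \<open>x \<mapsto> x + 1\<close> pull the class of
  \<open>\<kappa>(x, y) = \<bar>y\<bar> - \<bar>x\<bar>\<close> back to classes whose representatives differ by the coboundary of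
  \<open>\<psi> x = \<bar>x + 1\<bar> - \<bar>x\<bar>\<close>. For \<open>S = 1\<close>, every primitive is \<open>\<psi>\<close> plus a function constant on
  the integers, and since \<open>\<psi>\<close> is \<open>1\<close> on the nonnegative and \<open>-1\<close> on the negative integers, no
  primitive has finite \<open>1\<close>-norm.\<close>

definition nonincreasing_at :: "(nat \<Rightarrow> ennreal) \<Rightarrow> nat \<Rightarrow> bool" where
  "nonincreasing_at \<pi> k \<longleftrightarrow> (0 < k \<longrightarrow> \<pi> k \<le> \<pi> (k - 1))"

end

theory Submission
  imports Defs
begin

text \<open>A coarse embedding \<open>f\<close> maps each ball of radius at most \<open>S\<close> into a ball of a fixed radius \<open>R'\<close>, and
  for \<open>l\<close> large the new balls, dilated by \<open>l'\<close>, are disjoint whenever the old ones, dilated by \<open>l\<close>, are: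
  if two of them met, the old centres would be close, since preimages of balls under \<open>f\<close> are bounded. So \<open>f\<close>
  carries packings to packings and pulling back is norm-nonincreasing. With \<open>R'\<close> increased by the
  distance from \<open>f\<close> to \<open>g\<close>, the same target balls serve \<open>g\<close>, and the antisymmetrized prism operator is a
  bounded homotopy from \<open>f\<close> to \<open>g\<close>.

  The Leibniz rule and the prism identity hold for arbitrary functions on lists and pass to
  skew-symmetric cochains by antisymmetrization, which commutes with the coboundary.\<close>

section \<open>Cochains on lists of points\<close>

text \<open>Cochains are controlled only on simplices of their size and are 0 by convention on all
  other lists, while \<open>f\<close> need not be injective and may send a simplex to a degenerate
  tuple. Skew-symmetry reconciles the two: a skew-symmetric function vanishes on tuples with
  repetitions, so pullback still commutes with the coboundary and the cup-product. The homotopy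
  meets a similar obstacle: it evaluates cochains on tuples mixing \<open>f\<close>- and
  \<open>g\<close>-images, and these must lie in one ball of radius \<open>S'\<close> for the
  cocycle condition to apply to them.

  Membership in the complex asks only for finite norms, so pointwise estimates on each ball with
  crude constants replace the classical inequalities for sums. A quantitative bound is needed for
  the pullback alone, where the constant 1 comes from reindexing a packing. Every image ball is
  given the same radius, so one can take \<open>S' = R'\<close>.\<close>

abbreviation omit :: "nat \<Rightarrow> 'a list \<Rightarrow> 'a list" where
  "omit i xs \<equiv> take i xs @ drop (Suc i) xs"

text \<open>The coboundary without restriction to simplices. Splitting off the first vertex lets the
  Leibniz rule and the prism identity be proved by induction instead of by rearranging double sums.
  On a singleton it is the augmentation \<open>delta \<phi> [x] = \<phi> []\<close>.\<close>

primrec delta :: "('a list \<Rightarrow> real) \<Rightarrow> 'a list \<Rightarrow> real" where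
  "delta \<phi> [] = 0"
| "delta \<phi> (x # xs) = \<phi> xs - delta (\<lambda>ys. \<phi> (x # ys)) xs"

lemma delta_eq_sum: "delta \<phi> xs = (\<Sum>i<length xs. (-1) ^ i * \<phi> (omit i xs))"
proof (induction xs arbitrary: \<phi>)
  case (Cons x xs)
  show ?case
    by (simp add: Cons.IH sum.lessThan_Suc_shift sum_negf del: sum.lessThan_Suc)
qed simp

lemma delta_cong:
  assumes "\<And>i. i < length xs \<Longrightarrow> \<phi> (omit i xs) = \<psi> (omit i xs)"
  shows "delta \<phi> xs = delta \<psi> xs"
  using assms by (simp add: delta_eq_sum)

lemma delta_add: "delta (\<lambda>ys. \<phi> ys + \<psi> ys) xs = delta \<phi> xs + delta \<psi> xs"
  by (simp add: delta_eq_sum sum.distrib algebra_simps)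

lemma delta_cmult: "delta (\<lambda>ys. a * \<phi> ys) xs = a * delta \<phi> xs"
  by (simp add: delta_eq_sum sum_distrib_left algebra_simps)

lemma delta_diff: "delta (\<lambda>ys. \<phi> ys - \<psi> ys) xs = delta \<phi> xs - delta \<psi> xs"
  by (simp add: delta_eq_sum sum_subtractf algebra_simps)

lemma delta_map: "delta (\<lambda>ys. \<phi> (map f ys)) xs = delta \<phi> (map f xs)"
  by (induction xs arbitrary: \<phi>) simp_all

section \<open>The Leibniz rule for the front-face/back-face product\<close>

definition raw_cup :: "nat \<Rightarrow> ('a list \<Rightarrow> real) \<Rightarrow> ('a list \<Rightarrow> real) \<Rightarrow> 'a list \<Rightarrow> real" where
  "raw_cup k \<kappa> \<mu> xs = \<kappa> (take (Suc k) xs) * \<mu> (drop k xs)"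

text \<open>Omitting the last vertex of the longer front face and omitting the first vertex of the
  longer back face give the same product with opposite signs, so these two extra terms cancel. The
  length bound ensures that \<open>take (Suc (Suc k)) xs\<close> has its full length.\<close>

lemma delta_raw_cup:
  assumes "Suc (Suc k) \<le> length xs"
  shows "delta (raw_cup k \<kappa> \<mu>) xs =
    raw_cup (Suc k) (delta \<kappa>) \<mu> xs + (-1) ^ k * raw_cup k \<kappa> (delta \<mu>) xs"
  using assms
proof (induction k arbitrary: \<kappa> xs)
  case 0
  then obtain x y zs where xs: "xs = x # y # zs"
    by (metis Suc_le_length_iff)
  \<comment> \<open>With a front face of one vertex, fixing that vertex turns the product into a
    constant multiple of a function of the rest.\<close>
  have "(\<lambda>ys. raw_cup 0 \<kappa> \<mu> (x # ys)) = (\<lambda>ys. \<kappa> [x] * \<mu> (x # ys))"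
    by (simp add: raw_cup_def)
  then have "delta (raw_cup 0 \<kappa> \<mu>) xs =
      \<kappa> [y] * \<mu> (y # zs) - \<kappa> [x] * delta (\<lambda>ys. \<mu> (x # ys)) (y # zs)"
    unfolding xs by (simp only: delta.simps(2)[of _ x] delta_cmult) (simp add: raw_cup_def)
  then show ?case
    by (simp add: raw_cup_def xs algebra_simps)
next
  case (Suc k)
  then obtain x ys where xs: "xs = x # ys" and len: "Suc (Suc k) \<le> length ys"
    by (metis Suc_le_length_iff)
  have eq: "(\<lambda>ys. raw_cup (Suc k) \<kappa> \<mu> (x # ys)) = raw_cup k (\<lambda>ys. \<kappa> (x # ys)) \<mu>"
    by (simp add: raw_cup_def fun_eq_iff)
  have "delta (raw_cup (Suc k) \<kappa> \<mu>) xs =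
      raw_cup (Suc k) \<kappa> \<mu> ys - delta (raw_cup k (\<lambda>ys. \<kappa> (x # ys)) \<mu>) ys"
    unfolding xs by (simp add: eq)
  also have "\<dots> = raw_cup (Suc k) \<kappa> \<mu> ys - (raw_cup (Suc k) (delta (\<lambda>ys. \<kappa> (x # ys))) \<mu> ys +
      (-1) ^ k * raw_cup k (\<lambda>ys. \<kappa> (x # ys)) (delta \<mu>) ys)"
    by (simp only: Suc.IH[OF len])
  also have "\<dots> = raw_cup (Suc (Suc k)) (delta \<kappa>) \<mu> xs +
      (-1) ^ Suc k * raw_cup (Suc k) \<kappa> (delta \<mu>) xs"
    by (simp add: raw_cup_def xs algebra_simps)
  finally show ?case .
qed

section \<open>The prism operator between two maps\<close>

primrec prism ::
  "('a \<Rightarrow> 'b) \<Rightarrow> ('a \<Rightarrow> 'b) \<Rightarrow> ('b list \<Rightarrow> real) \<Rightarrow> 'a list \<Rightarrow> real" where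
  "prism f g \<phi> [] = 0"
| "prism f g \<phi> (x # xs) =
     \<phi> (f x # g x # map g xs) - prism f g (\<lambda>ys. \<phi> (f x # ys)) xs"

lemma prism_diff:
  "prism f g (\<lambda>ys. \<phi> ys - \<psi> ys) xs = prism f g \<phi> xs - prism f g \<psi> xs"
  by (induction xs arbitrary: \<phi> \<psi>) simp_all

text \<open>Unrolled, \<open>prism f g \<phi>\<close> is the sum over i of (-1)^i times the value of
  \<open>\<phi>\<close> at (f x_0, ..., f x_i, g x_i, ..., g x_n). Inner faces of neighbouring terms
  cancel and the two ends of the prism remain. The value 0 on the empty list removes the
  augmentation term for singletons.\<close>

lemma prism_homotopy:
  "prism f g (delta \<phi>) xs + delta (prism f g \<phi>) xs = \<phi> (map g xs) - \<phi> (map f xs)"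
proof (induction xs arbitrary: \<phi>)
  case (Cons x xs)
  have "(\<lambda>ys. delta \<phi> (f x # ys)) = (\<lambda>ys. \<phi> ys - delta (\<lambda>ys. \<phi> (f x # ys)) ys)"
    by simp
  then have "prism f g (\<lambda>ys. delta \<phi> (f x # ys)) xs =
      prism f g \<phi> xs - prism f g (delta (\<lambda>ys. \<phi> (f x # ys))) xs"
    by (simp add: prism_diff)
  moreover have "delta (\<lambda>ys. \<phi> (f x # g x # map g ys)) xs =
      delta (\<lambda>ys. \<phi> (f x # g x # ys)) (map g xs)"
    by (rule delta_map)
  ultimately show ?case
    using Cons.IH[of "\<lambda>ys. \<phi> (f x # ys)"] by (simp add: delta_diff)
qed simp

text \<open>Every term of the prism evaluates \<open>\<phi>\<close> on a list of this kind. It is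
  applied to the coboundary of a cocycle, which is known to vanish only on tuples contained in a
  small ball.\<close>

lemma prism_eq_0:
  assumes "\<And>ys. length ys = Suc (length xs) \<Longrightarrow> set ys \<subseteq> f ` set xs \<union> g ` set xs \<Longrightarrow> \<phi> ys = 0"
  shows "prism f g \<phi> xs = 0"
  using assms
proof (induction xs arbitrary: \<phi>)
  case (Cons x xs)
  have "prism f g (\<lambda>ys. \<phi> (f x # ys)) xs = 0"
    by (rule Cons.IH, rule Cons.prems) auto
  moreover have "\<phi> (f x # g x # map g xs) = 0"
    by (rule Cons.prems) auto
  ultimately show ?case by simp
qed simp

text \<open>The prism has \<open>length xs\<close> terms, and \<open>zs\<close> is one at which
  \<open>\<phi>\<close> is largest in absolute value. Bounding by the value at a single tuple suits
  norms that take a supremum over the tuples in each ball.\<close>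

lemma prism_bound:
  assumes "xs \<noteq> []"
  obtains zs where "length zs = Suc (length xs)" "set zs \<subseteq> f ` set xs \<union> g ` set xs"
    "\<bar>prism f g \<phi> xs\<bar> \<le> real (length xs) * \<bar>\<phi> zs\<bar>"
proof -
  have "\<exists>zs. length zs = Suc (length xs) \<and> set zs \<subseteq> f ` set xs \<union> g ` set xs \<and>
      \<bar>prism f g \<phi> xs\<bar> \<le> real (length xs) * \<bar>\<phi> zs\<bar>"
    using assms
  proof (induction xs arbitrary: \<phi> rule: list_nonempty_induct)
    case (single x)
    show ?case by (intro exI[of _ "[f x, g x]"]) simp
  next
    case (cons x xs)
    obtain zs where zs: "length zs = Suc (length xs)" "set zs \<subseteq> f ` set xs \<union> g ` set xs"
      "\<bar>prism f g (\<lambda>ys. \<phi> (f x # ys)) xs\<bar> \<le> real (length xs) * \<bar>\<phi> (f x # zs)\<bar>"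
      using cons.IH[of "\<lambda>ys. \<phi> (f x # ys)"] by auto
    let ?a = "\<bar>\<phi> (f x # g x # map g xs)\<bar>" and ?b = "\<bar>\<phi> (f x # zs)\<bar>"
    have *: "\<bar>prism f g \<phi> (x # xs)\<bar> \<le> ?a + real (length xs) * ?b"
      using zs(3) by simp
    show ?case
    proof (cases "?a \<le> ?b")
      case True
      then show ?thesis using * zs(1,2)
        by (intro exI[of _ "f x # zs"]) (auto simp: algebra_simps)
    next
      case False
      then have "real (length xs) * ?b \<le> real (length xs) * ?a"
        by (intro mult_left_mono) auto
      then show ?thesis using *
        by (intro exI[of _ "f x # g x # map g xs"]) (auto simp: algebra_simps)
    qed
  qed
  then show ?thesis using that by blast
qed

section \<open>Skew-symmetric functions and antisymmetrization\<close>

definition skew :: "nat \<Rightarrow> ('a list \<Rightarrow> real) \<Rightarrow> bool" where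
  "skew n \<psi> \<longleftrightarrow> (\<forall>xs \<sigma>. length xs = n \<longrightarrow> \<sigma> permutes {..<n} \<longrightarrow>
     \<psi> (permute_list \<sigma> xs) = of_int (sign \<sigma>) * \<psi> xs)"

text \<open>Division by the factorial makes this a projection onto the skew-symmetric functions, and
  a signed average, so that one of its terms bounds it. Reading the length off the list lets one
  operator serve all degrees.\<close>

definition alt :: "('a list \<Rightarrow> real) \<Rightarrow> 'a list \<Rightarrow> real" where
  "alt \<phi> xs = (\<Sum>\<sigma> | \<sigma> permutes {..<length xs}. of_int (sign \<sigma>) * \<phi> (permute_list \<sigma> xs))
     / fact (length xs)"

abbreviation swap :: "nat \<Rightarrow> nat \<Rightarrow> nat \<Rightarrow> nat" where
  "swap \<equiv> Transposition.transpose"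

lemma permutation_if_permutes: "\<sigma> permutes {..<n::nat} \<Longrightarrow> permutation \<sigma>"
  using permutation_permutes by blast

lemma permute_list_transpose:
  assumes "i < length xs" "j < length xs"
  shows "permute_list (swap i j) xs = xs[i := xs ! j, j := xs ! i]"
  using assms
  by (intro nth_equalityI)
    (auto simp: permute_list_nth permutes_swap_id nth_list_update Transposition.transpose_def)

text \<open>Exchanging two equal entries fixes the list but reverses the sign. This disposes of the
  degenerate tuples that arise when a map identifies vertices of a simplex.\<close>

lemma skew_eq_0:
  assumes "skew (length xs) \<psi>" "\<not> distinct xs"
  shows "\<psi> xs = 0"
proof -
  obtain i j where ij: "i < length xs" "j < length xs" "i \<noteq> j" "xs ! i = xs ! j"
    using assms(2) by (auto simp: distinct_conv_nth)
  have "permute_list (swap i j) xs = xs"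
    using ij by (simp add: permute_list_transpose) (metis list_update_id)
  moreover have "\<psi> (permute_list (swap i j) xs) = of_int (sign (swap i j)) * \<psi> xs"
    using assms(1) ij by (simp add: skew_def permutes_swap_id)
  ultimately show ?thesis using ij by (simp add: sign_swap_id)
qed

lemma skew_alt: "skew n (alt \<phi>)"
  unfolding skew_def
proof (intro allI impI)
  fix xs :: "'a list" and \<tau> :: "nat \<Rightarrow> nat"
  assume len: "length xs = n" and \<tau>: "\<tau> permutes {..<n}"
  \<comment> \<open>Composing with \<open>\<tau>\<close> on the left rearranges the list by
    \<open>\<tau>\<close> first, because \<open>permute_list\<close> reverses the order of
    composition.\<close>
  have "(\<Sum>\<sigma> | \<sigma> permutes {..<n}. of_int (sign \<sigma>) * \<phi> (permute_list \<sigma> xs)) =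
      (\<Sum>\<sigma> | \<sigma> permutes {..<n}. of_int (sign (\<tau> \<circ> \<sigma>)) * \<phi> (permute_list (\<tau> \<circ> \<sigma>) xs))"
    by (rule setum_permutations_compose_left[OF \<tau>])
  also have "\<dots> = (\<Sum>\<sigma> | \<sigma> permutes {..<n}. of_int (sign \<tau>) *
      (of_int (sign \<sigma>) * \<phi> (permute_list \<sigma> (permute_list \<tau> xs))))"
    using \<tau> len by (intro sum.cong)
      (auto simp: sign_compose permutation_if_permutes permute_list_compose)
  finally have "alt \<phi> xs = of_int (sign \<tau>) * alt \<phi> (permute_list \<tau> xs)"
    by (simp add: alt_def len sum_distrib_left)
  then show "alt \<phi> (permute_list \<tau> xs) = of_int (sign \<tau>) * alt \<phi> xs"
    by (simp add: sign_def)
qed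

lemma alt_cong:
  assumes "\<And>\<sigma>. \<sigma> permutes {..<length xs} \<Longrightarrow> \<phi> (permute_list \<sigma> xs) = \<psi> (permute_list \<sigma> xs)"
  shows "alt \<phi> xs = alt \<psi> xs"
  using assms by (simp add: alt_def)

lemma alt_skew:
  assumes "skew (length xs) \<psi>"
  shows "alt \<psi> xs = \<psi> xs"
proof -
  have "of_int (sign \<sigma>) * \<psi> (permute_list \<sigma> xs) = \<psi> xs" if "\<sigma> permutes {..<length xs}" for \<sigma>
    using assms that by (simp add: skew_def sign_def)
  then show ?thesis
    by (simp add: alt_def card_permutations)
qed

lemma alt_add: "alt (\<lambda>ys. \<phi> ys + \<psi> ys) xs = alt \<phi> xs + alt \<psi> xs"
  by (simp add: alt_def sum.distrib algebra_simps add_divide_distrib)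

lemma alt_cmult: "alt (\<lambda>ys. a * \<phi> ys) xs = a * alt \<phi> xs"
  by (simp add: alt_def sum_distrib_left algebra_simps)

lemma alt_map: "alt (\<lambda>ys. \<phi> (map f ys)) xs = alt \<phi> (map f xs)"
  by (simp add: alt_def permute_list_map)

lemma alt_bound:
  obtains \<sigma> where "\<sigma> permutes {..<length xs}" "\<bar>alt \<phi> xs\<bar> \<le> \<bar>\<phi> (permute_list \<sigma> xs)\<bar>"
proof -
  let ?P = "{\<sigma>. \<sigma> permutes {..<length xs}}" and ?h = "\<lambda>\<sigma>. \<bar>\<phi> (permute_list \<sigma> xs)\<bar>"
  have fin: "finite ?P" by (simp add: finite_permutations)
  have ne: "?P \<noteq> {}" using permutes_id by blast
  have "Max (?h ` ?P) \<in> ?h ` ?P"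
    using fin ne by (intro Max_in) auto
  then obtain \<sigma> where \<sigma>: "\<sigma> permutes {..<length xs}" "?h \<sigma> = Max (?h ` ?P)"
    by auto
  have "\<bar>\<Sum>\<sigma>\<in>?P. of_int (sign \<sigma>) * \<phi> (permute_list \<sigma> xs)\<bar> \<le>
      (\<Sum>\<sigma>\<in>?P. \<bar>of_int (sign \<sigma>) * \<phi> (permute_list \<sigma> xs)\<bar>)"
    by (rule sum_abs)
  also have "\<dots> \<le> (\<Sum>\<tau>\<in>?P. ?h \<sigma>)"
    unfolding \<sigma>(2) using fin by (intro sum_mono) (auto simp: abs_mult sign_def)
  also have "\<dots> = fact (length xs) * ?h \<sigma>"
    by (simp add: card_permutations)
  finally have "\<bar>alt \<phi> xs\<bar> \<le> ?h \<sigma>"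
    by (simp add: alt_def divide_le_eq mult.commute)
  then show ?thesis using that \<sigma>(1) by blast
qed

text \<open>After the exchange, position \<open>Suc i\<close> holds the entry formerly at
  \<open>i\<close>. This relates the antisymmetrized sums for neighbouring omitted
  positions.\<close>

lemma omit_permute_adjacent:
  assumes "Suc i < length xs"
  shows "omit (Suc i) (permute_list (swap i (Suc i)) xs) = omit i xs"
proof -
  have "xs = take i xs @ xs ! i # xs ! Suc i # drop (Suc (Suc i)) xs"
    using assms by (simp add: Cons_nth_drop_Suc)
  then obtain us a b vs where xs: "xs = us @ a # b # vs" and i: "length us = i"
    using assms by (metis Suc_lessD length_take min.absorb4)
  have "permute_list (swap i (Suc i)) xs = us @ b # a # vs"
    unfolding xs i[symmetric]
    by (subst permute_list_transpose) (simp_all add: list_update_append nth_append)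
  then show ?thesis
    unfolding xs i[symmetric] by simp
qed

lemma skew_adjacent:
  assumes "skew (Suc (Suc (length us + length vs))) \<psi>"
  shows "\<psi> (us @ a # b # vs) = - \<psi> (us @ b # a # vs)"
proof -
  let ?i = "length us"
  have "permute_list (swap ?i (Suc ?i)) (us @ b # a # vs) = us @ a # b # vs"
    by (subst permute_list_transpose) (simp_all add: list_update_append nth_append)
  moreover have "swap ?i (Suc ?i) permutes {..<Suc (Suc (length us + length vs))}"
    by (intro permutes_swap_id) auto
  ultimately show ?thesis
    using assms[unfolded skew_def, rule_format, of "us @ b # a # vs" "swap ?i (Suc ?i)"]
    by (simp add: sign_swap_id)
qed

text \<open>The entry \<open>y\<close> passes the entries of \<open>vs\<close> one at a time, each
  exchange costing a sign.\<close>

lemma skew_shift: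
  assumes "skew (Suc (length us + length vs)) \<psi>"
  shows "\<psi> (us @ y # vs) = (-1) ^ length vs * \<psi> (us @ vs @ [y])"
  using assms
proof (induction vs arbitrary: us)
  case (Cons b vs)
  have "\<psi> (us @ y # b # vs) = - \<psi> ((us @ [b]) @ y # vs)"
    using skew_adjacent[of us vs \<psi> y b] Cons.prems by simp
  also have "\<psi> ((us @ [b]) @ y # vs) = (-1) ^ length vs * \<psi> ((us @ [b]) @ vs @ [y])"
    by (rule Cons.IH) (use Cons.prems in simp)
  finally show ?case by simp
qed simp

text \<open>The exchange followed by the omission leaves the face without entry \<open>b\<close>,
  except that the old last entry sits at position \<open>b\<close>. Moving it to the end passes
  \<open>n - b - 1\<close> entries; with the minus sign of the exchange, the parity is that of
  \<open>n + b\<close>.\<close>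

lemma skew_omit_transpose:
  assumes "skew n \<psi>" "length xs = Suc n" "b < n"
  shows "- \<psi> (omit n (permute_list (swap n b) xs)) = (-1) ^ (n + b) * \<psi> (omit b xs)"
proof -
  have "xs = take b xs @ xs ! b # drop (Suc b) xs"
    using assms by (simp add: id_take_nth_drop)
  moreover have "drop (Suc b) xs \<noteq> []" using assms by simp
  ultimately obtain us x vs y where xs: "xs = us @ x # vs @ [y]" and b: "length us = b"
    using assms by (metis append_butlast_last_id length_take less_SucI min.absorb4)
  have n: "n = Suc (length us + length vs)"
    using assms(2) by (simp add: xs)
  have "permute_list (swap n b) xs = us @ y # vs @ [x]"
    unfolding xs b[symmetric] n
    by (subst permute_list_transpose) (simp_all add: list_update_append nth_append)
  then have "- \<psi> (omit n (permute_list (swap n b) xs)) = - \<psi> (us @ y # vs)"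
    by (simp add: n)
  also have "\<dots> = (-1) ^ Suc (length vs) * \<psi> (us @ vs @ [y])"
    using skew_shift[of us vs \<psi> y] assms(1) n by simp
  also have "(-1 :: real) ^ Suc (length vs) = (-1) ^ (n + b)"
    by (simp add: n b[symmetric] power_add)
  finally show ?thesis by (simp add: xs b[symmetric])
qed

text \<open>All omitted positions contribute equally to the antisymmetrized coboundary, so it
  suffices to omit the last one. The permutations are then sorted by the vertex that they place
  last; for each such vertex, what remains is an antisymmetrization over the opposite face.\<close>

lemma delta_alt: "delta (alt \<phi>) xs = alt (delta \<phi>) xs"
proof (cases xs)
  case Nil
  then show ?thesis by (simp add: alt_def)
next
  case (Cons x0 xs0)
  define n where "n = length xs0"
  have len: "length xs = Suc n" by (simp add: Cons n_def)
  define G where "G i = (\<Sum>\<sigma> | \<sigma> permutes {..<Suc n}.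
      of_int (sign \<sigma>) * \<phi> (omit i (permute_list \<sigma> xs)))" for i
  have G_Suc: "G (Suc i) = - G i" if "i < n" for i
  proof -
    let ?\<tau> = "swap i (Suc i)"
    have \<tau>: "?\<tau> permutes {..<Suc n}" using that by (intro permutes_swap_id) auto
    have "G (Suc i) = (\<Sum>\<sigma> | \<sigma> permutes {..<Suc n}.
      of_int (sign (\<sigma> \<circ> ?\<tau>)) * \<phi> (omit (Suc i) (permute_list (\<sigma> \<circ> ?\<tau>) xs)))"
      unfolding G_def by (rule sum_permutations_compose_right[OF \<tau>])
    also have "\<dots> = (\<Sum>\<sigma> | \<sigma> permutes {..<Suc n}.
      - (of_int (sign \<sigma>) * \<phi> (omit i (permute_list \<sigma> xs))))"
    proof (intro sum.cong refl, clarify)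
      fix \<sigma> assume \<sigma>: "\<sigma> permutes {..<Suc n}"
      have "permute_list (\<sigma> \<circ> ?\<tau>) xs = permute_list ?\<tau> (permute_list \<sigma> xs)"
        using \<tau> len by (intro permute_list_compose) simp
      then have "omit (Suc i) (permute_list (\<sigma> \<circ> ?\<tau>) xs) = omit i (permute_list \<sigma> xs)"
        using omit_permute_adjacent[of i "permute_list \<sigma> xs"] that len by simp
      moreover have "sign (\<sigma> \<circ> ?\<tau>) = - sign \<sigma>"
        using \<sigma> \<tau> by (simp add: sign_compose permutation_if_permutes sign_swap_id)
      ultimately show "of_int (sign (\<sigma> \<circ> ?\<tau>)) * \<phi> (omit (Suc i) (permute_list (\<sigma> \<circ> ?\<tau>) xs)) =
          - (of_int (sign \<sigma>) * \<phi> (omit i (permute_list \<sigma> xs)))"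
        by simp
    qed
    also have "\<dots> = - G i" by (simp add: G_def sum_negf)
    finally show ?thesis .
  qed
  have G_0: "(-1) ^ i * G i = G 0" if "i \<le> n" for i
    using that by (induction i) (simp_all add: G_Suc)
  have "(\<Sum>\<sigma> | \<sigma> permutes {..<Suc n}. of_int (sign \<sigma>) * delta \<phi> (permute_list \<sigma> xs)) =
      (\<Sum>i<Suc n. (-1) ^ i * G i)"
    by (simp add: delta_eq_sum len G_def sum_distrib_left mult.left_commute del: sum.lessThan_Suc)
      (rule sum.swap)
  also have "\<dots> = (\<Sum>i<Suc n. G 0)"
    using G_0 by (intro sum.cong) auto
  also have "\<dots> = real (Suc n) * ((-1) ^ n * G n)"
    using G_0[of n] by simp
  \<comment> \<open>The factor \<open>Suc n\<close> turns \<open>fact (Suc n)\<close> into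
    \<open>fact n\<close>, the normalization of \<open>alt\<close> on faces.\<close>
  finally have 1: "alt (delta \<phi>) xs = (-1) ^ n * G n / fact n"
    by (simp add: alt_def len del: of_nat_Suc)
  \<comment> \<open>Since \<open>q\<close> fixes position \<open>n\<close>, it only reorders what is
    left after the last entry is dropped.\<close>
  have perm: "omit n (permute_list (swap n b \<circ> q) xs) =
      permute_list q (omit n (permute_list (swap n b) xs))"
    if "b < Suc n" "q permutes {..<n}" for b q
  proof (rule nth_equalityI)
    have q: "q permutes {..<Suc n}" using that(2) by (rule permutes_subset) auto
    have t: "swap n b permutes {..<Suc n}" using that(1) by (intro permutes_swap_id) auto
    have tq: "swap n b \<circ> q permutes {..<Suc n}" using q t by (rule permutes_compose)
    fix i assume i: "i < length (omit n (permute_list (swap n b \<circ> q) xs))"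
    then have i: "i < n" "q i < n" "q i < Suc n"
      using len permutes_in_image[OF that(2), of i] by auto
    show "omit n (permute_list (swap n b \<circ> q) xs) ! i =
        permute_list q (omit n (permute_list (swap n b) xs)) ! i"
      using i that(2) t tq len by (simp add: permute_list_nth nth_append)
  qed (use len in simp)
  \<comment> \<open>Here \<open>b\<close> is the image of \<open>n\<close>, so \<open>xs ! b\<close>
    is the vertex that is moved to the end and omitted; for \<open>b = n\<close> there is no
    exchange.\<close>
  have "G n = (\<Sum>b\<in>insert n {..<n}. \<Sum>q | q permutes {..<n}.
      of_int (sign (swap n b \<circ> q)) * \<phi> (omit n (permute_list (swap n b \<circ> q) xs)))"
    unfolding G_def lessThan_Suc by (rule sum_over_permutations_insert) auto
  also have "\<dots> = (\<Sum>b\<in>insert n {..<n}. of_int (sign (swap n b)) * (\<Sum>q | q permutes {..<n}.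
      of_int (sign q) * \<phi> (permute_list q (omit n (permute_list (swap n b) xs)))))"
    unfolding sum_distrib_left
  proof (intro sum.cong refl, clarify)
    fix b q assume b: "b \<in> insert n {..<n}" and q: "q permutes {..<n}"
    have "sign (swap n b \<circ> q) = sign (swap n b) * sign q"
      using q by (intro sign_compose permutation_swap_id permutation_if_permutes)
    then show "of_int (sign (swap n b \<circ> q)) * \<phi> (omit n (permute_list (swap n b \<circ> q) xs)) =
      of_int (sign (swap n b)) *
        (of_int (sign q) * \<phi> (permute_list q (omit n (permute_list (swap n b) xs))))"
      using b q by (subst perm) (auto simp: less_Suc_eq)
  qed
  also have "\<dots> = (\<Sum>b\<in>insert n {..<n}. of_int (sign (swap n b)) *
      (fact n * alt \<phi> (omit n (permute_list (swap n b) xs))))"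
    using len by (simp add: alt_def)
  also have "\<dots> = (\<Sum>b\<in>insert n {..<n}. fact n * ((-1) ^ (n + b) * alt \<phi> (omit b xs)))"
  proof (rule sum.cong[OF refl])
    fix b assume b: "b \<in> insert n {..<n}"
    show "of_int (sign (swap n b)) * (fact n * alt \<phi> (omit n (permute_list (swap n b) xs))) =
        fact n * ((-1) ^ (n + b) * alt \<phi> (omit b xs))"
    proof (cases "b = n")
      case True
      then show ?thesis by (simp add: sign_id flip: mult_2)
    next
      case False
      then show ?thesis using skew_omit_transpose[OF skew_alt, of xs n b \<phi>] b len
        by (simp add: sign_swap_id flip: mult_minus_right)
    qed
  qed
  also have "\<dots> = fact n * ((-1) ^ n * delta (alt \<phi>) xs)"
    by (simp add: delta_eq_sum len sum_distrib_left power_add lessThan_Suc algebra_simps)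
  finally have "(-1) ^ n * G n / fact n = ((-1) ^ n * (-1) ^ n) * delta (alt \<phi>) xs"
    by simp
  then show ?thesis
    by (simp add: 1 flip: power_mult_distrib)
qed

text \<open>On lists of length \<open>n\<close>, \<open>\<psi>\<close> equals
  \<open>alt \<psi>\<close>, and \<open>delta (alt \<psi>)\<close> is itself an
  antisymmetrization.\<close>

lemma skew_delta:
  assumes "skew n \<psi>"
  shows "skew (Suc n) (delta \<psi>)"
proof -
  have "delta \<psi> xs = alt (delta \<psi>) xs" if "length xs = Suc n" for xs
  proof -
    have "delta \<psi> xs = delta (alt \<psi>) xs"
      using assms that by (intro delta_cong alt_skew[symmetric]) simp
    then show ?thesis by (simp add: delta_alt)
  qed
  then show ?thesis
    using skew_alt[of "Suc n" "delta \<psi>"] by (simp add: skew_def)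
qed

section \<open>Packing norms\<close>

definition tuples :: "nat \<Rightarrow> 'a::metric_space \<Rightarrow> real \<Rightarrow> 'a list set" where
  "tuples k c r = {xs. length xs = Suc k \<and> set xs \<subseteq> ball c r}"

definition local_sup :: "real \<Rightarrow> nat \<Rightarrow> 'a::metric_space cochain \<Rightarrow> 'a \<times> real \<Rightarrow> ennreal" where
  "local_sup p k \<kappa> = (\<lambda>(c, r). SUP xs\<in>tuples k c r. ennreal (\<bar>\<kappa> xs\<bar> powr p))"

lemma packing_norm_infinite:
  "packing_norm \<infinity> l R S k \<kappa> =
     (SUP P\<in>packings l R S. SUP (c, r)\<in>P. SUP xs\<in>tuples k c r. ennreal \<bar>\<kappa> xs\<bar>)"
  by (simp add: packing_norm_def tuples_def)

lemma packing_norm_finite: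
  "p \<noteq> \<infinity> \<Longrightarrow> packing_norm p l R S k \<kappa> =
     (SUP P\<in>packings l R S. ennreal_powr (infsum (local_sup (enn2real p) k \<kappa>) P) (1 / enn2real p))"
  by (simp add: packing_norm_def tuples_def local_sup_def)

lemma ennreal_powr_mono: "0 \<le> a \<Longrightarrow> x \<le> y \<Longrightarrow> ennreal_powr x a \<le> ennreal_powr y a"
  by (auto simp: ennreal_powr_def top_unique less_top intro!: ennreal_leI powr_mono2 enn2real_mono)

lemma packings_subset: "P \<in> packings l R S \<Longrightarrow> Q \<subseteq> P \<Longrightarrow> Q \<in> packings l R S"
  unfolding packings_def by (auto intro: pairwise_subset)

lemma packings_single: "R \<le> r \<Longrightarrow> r \<le> S \<Longrightarrow> {(c, r)} \<in> packings l R S"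
  by (simp add: packings_def)

lemma packings_radius: "P \<in> packings l R S \<Longrightarrow> (c, r) \<in> P \<Longrightarrow> R \<le> r \<and> r \<le> S"
  by (auto simp: packings_def)

lemma local_sup_upper:
  "xs \<in> tuples k c r \<Longrightarrow> ennreal (\<bar>\<kappa> xs\<bar> powr p) \<le> local_sup p k \<kappa> (c, r)"
  by (auto simp: local_sup_def intro: SUP_upper)

text \<open>An infinite sum of nonnegative terms is the supremum of its finite partial sums, and
  finite subsets of packings are packings. Finiteness thus becomes a uniform bound on finite sums,
  free of roots. A negative \<open>C\<close> stands for the bound 0.\<close>

lemma packing_norm_less_top_iff:
  assumes "p \<noteq> \<infinity>" and p: "0 < enn2real p"
  shows "packing_norm p l R S k \<kappa> < \<infinity> \<longleftrightarrow>
    (\<exists>C. \<forall>P\<in>packings l R S. finite P \<longrightarrow> sum (local_sup (enn2real p) k \<kappa>) P \<le> ennreal C)"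
proof
  assume "packing_norm p l R S k \<kappa> < \<infinity>"
  then obtain D where "0 \<le> D" and D: "packing_norm p l R S k \<kappa> = ennreal D"
    by (cases "packing_norm p l R S k \<kappa>") auto
  have "sum (local_sup (enn2real p) k \<kappa>) P \<le> ennreal (D powr enn2real p)"
    if "P \<in> packings l R S" "finite P" for P
  proof -
    let ?s = "sum (local_sup (enn2real p) k \<kappa>) P"
    have le: "ennreal_powr ?s (1 / enn2real p) \<le> ennreal D"
      using that SUP_upper[of P "packings l R S"
          "\<lambda>P. ennreal_powr (infsum (local_sup (enn2real p) k \<kappa>) P) (1 / enn2real p)"]
      by (simp add: packing_norm_finite[OF assms(1)] flip: D)
    then obtain y where "0 \<le> y" and y: "?s = ennreal y"
      by (cases ?s) (auto simp: ennreal_powr_def top_unique)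
    then have "y powr (1 / enn2real p) \<le> D"
      using le \<open>0 \<le> D\<close> by (simp add: ennreal_powr_def)
    then have "(y powr (1 / enn2real p)) powr enn2real p \<le> D powr enn2real p"
      using p by (intro powr_mono2) auto
    then show ?thesis
      using p \<open>0 \<le> y\<close> by (simp add: y powr_powr ennreal_leI)
  qed
  then show "\<exists>C. \<forall>P\<in>packings l R S. finite P \<longrightarrow> sum (local_sup (enn2real p) k \<kappa>) P \<le> ennreal C"
    by blast
next
  assume "\<exists>C. \<forall>P\<in>packings l R S. finite P \<longrightarrow> sum (local_sup (enn2real p) k \<kappa>) P \<le> ennreal C"
  then obtain C where
    C: "P \<in> packings l R S \<Longrightarrow> finite P \<Longrightarrow> sum (local_sup (enn2real p) k \<kappa>) P \<le> ennreal C" for P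
    by blast
  have "infsum (local_sup (enn2real p) k \<kappa>) P \<le> ennreal C" if "P \<in> packings l R S" for P
    using that packings_subset by (auto simp: nonneg_infsum_complete intro!: SUP_least C)
  then have "packing_norm p l R S k \<kappa> \<le> ennreal_powr (ennreal C) (1 / enn2real p)"
    unfolding packing_norm_finite[OF assms(1)] by (intro SUP_least ennreal_powr_mono) simp_all
  also have "\<dots> < \<infinity>" by (simp add: ennreal_powr_def)
  finally show "packing_norm p l R S k \<kappa> < \<infinity>" .
qed

lemma packing_norm_infinite_less_top_iff:
  "packing_norm \<infinity> l R S k \<kappa> < \<infinity> \<longleftrightarrow>
    (\<exists>C. \<forall>c r. R \<le> r \<longrightarrow> r \<le> S \<longrightarrow> (\<forall>xs\<in>tuples k c r. \<bar>\<kappa> xs\<bar> \<le> C))"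
proof
  assume "packing_norm \<infinity> l R S k \<kappa> < \<infinity>"
  then obtain D where "0 \<le> D" and D: "packing_norm \<infinity> l R S k \<kappa> = ennreal D"
    by (cases "packing_norm \<infinity> l R S k \<kappa>") auto
  have "\<bar>\<kappa> xs\<bar> \<le> D" if "R \<le> r" "r \<le> S" "xs \<in> tuples k c r" for c r xs
  proof -
    have "ennreal \<bar>\<kappa> xs\<bar> \<le> (SUP (c, r)\<in>{(c, r)}. SUP xs\<in>tuples k c r. ennreal \<bar>\<kappa> xs\<bar>)"
      using that by (auto intro: SUP_upper)
    also have "\<dots> \<le> packing_norm \<infinity> l R S k \<kappa>"
      unfolding packing_norm_infinite
      by (rule SUP_upper[OF packings_single]) (use that in auto)
    finally have "ennreal \<bar>\<kappa> xs\<bar> \<le> ennreal D" unfolding D .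
    then show ?thesis using \<open>0 \<le> D\<close> by simp
  qed
  then show "\<exists>C. \<forall>c r. R \<le> r \<longrightarrow> r \<le> S \<longrightarrow> (\<forall>xs\<in>tuples k c r. \<bar>\<kappa> xs\<bar> \<le> C)"
    by blast
next
  assume "\<exists>C. \<forall>c r. R \<le> r \<longrightarrow> r \<le> S \<longrightarrow> (\<forall>xs\<in>tuples k c r. \<bar>\<kappa> xs\<bar> \<le> C)"
  then obtain C where C: "\<And>c r xs. R \<le> r \<Longrightarrow> r \<le> S \<Longrightarrow> xs \<in> tuples k c r \<Longrightarrow> \<bar>\<kappa> xs\<bar> \<le> C"
    by blast
  have "packing_norm \<infinity> l R S k \<kappa> \<le> ennreal C"
    unfolding packing_norm_infinite
    by (intro SUP_least) (auto intro!: SUP_least ennreal_leI dest: packings_radius C)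
  also have "\<dots> < \<infinity>" by simp
  finally show "packing_norm \<infinity> l R S k \<kappa> < \<infinity>" .
qed

lemma finite_exponent:
  assumes "1 \<le> p" "p \<noteq> (\<infinity> :: ennreal)"
  shows "1 \<le> enn2real p"
  using assms by (cases p) auto

text \<open>A single ball is a packing, so one summand is already controlled by the norm, whatever
  the exponent. This bound is what permits passing to larger exponents and multiplying by a factor
  of infinite exponent.\<close>

lemma packing_norm_bounded:
  assumes "packing_norm p l R S k \<kappa> < \<infinity>" "1 \<le> p"
  obtains C where "0 \<le> C" "\<And>c r xs. R \<le> r \<Longrightarrow> r \<le> S \<Longrightarrow> xs \<in> tuples k c r \<Longrightarrow> \<bar>\<kappa> xs\<bar> \<le> C"
proof (cases "p = \<infinity>")
  case True
  then obtain C where "\<And>c r xs. R \<le> r \<Longrightarrow> r \<le> S \<Longrightarrow> xs \<in> tuples k c r \<Longrightarrow> \<bar>\<kappa> xs\<bar> \<le> C"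
    using assms(1) unfolding True packing_norm_infinite_less_top_iff by blast
  then show ?thesis by (intro that[of "max C 0"]) (auto intro: max.coboundedI1)
next
  case False
  define q where "q = enn2real p"
  have q: "1 \<le> q" using finite_exponent[OF assms(2) False] by (simp add: q_def)
  then obtain C where
    C: "P \<in> packings l R S \<Longrightarrow> finite P \<Longrightarrow> sum (local_sup q k \<kappa>) P \<le> ennreal C" for P
    using packing_norm_less_top_iff[OF False, THEN iffD1, OF _ assms(1)] by (auto simp: q_def)
  have "\<bar>\<kappa> xs\<bar> \<le> (max C 0) powr (1 / q)"
    if "R \<le> r" "r \<le> S" and xs: "xs \<in> tuples k c r" for c r xs
  proof -
    have "ennreal (\<bar>\<kappa> xs\<bar> powr q) \<le> local_sup q k \<kappa> (c, r)"
      by (rule local_sup_upper[OF xs])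
    also have "\<dots> \<le> ennreal C"
      using C[OF packings_single[OF that(1,2), of c l]] by simp
    \<comment> \<open>As \<open>ennreal\<close> sends negative reals to 0, the bound is made
      nonnegative before returning to the reals.\<close>
    also have "\<dots> \<le> ennreal (max C 0)"
      by (rule ennreal_leI) simp
    finally have "ennreal (\<bar>\<kappa> xs\<bar> powr q) \<le> ennreal (max C 0)" .
    then have "\<bar>\<kappa> xs\<bar> powr q \<le> max C 0"
      by (simp add: ennreal_le_iff)
    then have "(\<bar>\<kappa> xs\<bar> powr q) powr (1 / q) \<le> (max C 0) powr (1 / q)"
      using q by (intro powr_mono2) auto
    then show ?thesis using q by (simp add: powr_powr)
  qed
  then show ?thesis by (intro that[of "(max C 0) powr (1 / q)"]) auto
qed

text \<open>The comparison is between powers of values within one ball. Suprema can therefore be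
  taken ball by ball and the estimates summed over a packing, without comparing norms that involve
  different roots.\<close>

lemma packing_norm_dominated:
  assumes q: "1 \<le> q" "q \<noteq> \<infinity>" and p1: "1 \<le> p1" "p1 \<noteq> \<infinity>" and p2: "1 \<le> p2" "p2 \<noteq> \<infinity>"
    and "packing_norm p1 l R S k1 \<kappa>1 < \<infinity>" "packing_norm p2 l R S k2 \<kappa>2 < \<infinity>"
    and M: "0 \<le> M"
    and dom: "\<And>c r xs. R \<le> r \<Longrightarrow> r \<le> S \<Longrightarrow> xs \<in> tuples k c r \<Longrightarrow>
      \<exists>us\<in>tuples k1 c r. \<exists>vs\<in>tuples k2 c r.
        \<bar>\<kappa> xs\<bar> powr enn2real q \<le> M * (\<bar>\<kappa>1 us\<bar> powr enn2real p1 + \<bar>\<kappa>2 vs\<bar> powr enn2real p2)"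
  shows "packing_norm q l R S k \<kappa> < \<infinity>"
proof -
  have pos: "0 < enn2real q" "0 < enn2real p1" "0 < enn2real p2"
    using finite_exponent q p1 p2 by fastforce+
  let ?s = "local_sup (enn2real q) k \<kappa>" and ?s1 = "local_sup (enn2real p1) k1 \<kappa>1"
    and ?s2 = "local_sup (enn2real p2) k2 \<kappa>2"
  obtain C1 where C1: "P \<in> packings l R S \<Longrightarrow> finite P \<Longrightarrow> sum ?s1 P \<le> ennreal C1" for P
    using packing_norm_less_top_iff[OF p1(2) pos(2), THEN iffD1, OF assms(7)] by blast
  obtain C2 where C2: "P \<in> packings l R S \<Longrightarrow> finite P \<Longrightarrow> sum ?s2 P \<le> ennreal C2" for P
    using packing_norm_less_top_iff[OF p2(2) pos(3), THEN iffD1, OF assms(8)] by blast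
  have le: "?s (c, r) \<le> ennreal M * (?s1 (c, r) + ?s2 (c, r))" if r: "R \<le> r" "r \<le> S" for c r
    unfolding local_sup_def[of "enn2real q"] prod.case
  proof (rule SUP_least)
    fix xs assume "xs \<in> tuples k c r"
    then obtain us vs where uv: "us \<in> tuples k1 c r" "vs \<in> tuples k2 c r"
      and "\<bar>\<kappa> xs\<bar> powr enn2real q \<le> M * (\<bar>\<kappa>1 us\<bar> powr enn2real p1 + \<bar>\<kappa>2 vs\<bar> powr enn2real p2)"
      using dom r by blast
    then have "ennreal (\<bar>\<kappa> xs\<bar> powr enn2real q) \<le>
        ennreal (M * (\<bar>\<kappa>1 us\<bar> powr enn2real p1 + \<bar>\<kappa>2 vs\<bar> powr enn2real p2))"
      by (intro ennreal_leI)
    also have "\<dots> = ennreal M *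
        (ennreal (\<bar>\<kappa>1 us\<bar> powr enn2real p1) + ennreal (\<bar>\<kappa>2 vs\<bar> powr enn2real p2))"
      using M by (simp add: ennreal_mult)
    also have "\<dots> \<le> ennreal M * (?s1 (c, r) + ?s2 (c, r))"
      by (intro mult_left_mono add_mono local_sup_upper uv) simp
    finally show "ennreal (\<bar>\<kappa> xs\<bar> powr enn2real q) \<le> ennreal M * (?s1 (c, r) + ?s2 (c, r))" .
  qed
  have "sum ?s P \<le> ennreal (M * (max C1 0 + max C2 0))" if P: "P \<in> packings l R S" "finite P" for P
  proof -
    have "sum ?s P \<le> (\<Sum>B\<in>P. ennreal M * (?s1 B + ?s2 B))"
    proof (intro sum_mono)
      fix B assume "B \<in> P"
      then show "?s B \<le> ennreal M * (?s1 B + ?s2 B)"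
        using le[of "snd B" "fst B"] packings_radius[OF P(1), of "fst B" "snd B"] by simp
    qed
    also have "\<dots> = ennreal M * (sum ?s1 P + sum ?s2 P)"
      by (simp add: sum.distrib flip: sum_distrib_left)
    also have "\<dots> \<le> ennreal M * (ennreal (max C1 0) + ennreal (max C2 0))"
      using C1[OF P] C2[OF P]
      by (intro mult_left_mono add_mono) (auto simp: max_def ennreal_neg)
    also have "\<dots> = ennreal (M * (max C1 0 + max C2 0))"
      using M by (simp add: ennreal_mult)
    finally show ?thesis .
  qed
  then show ?thesis
    using packing_norm_less_top_iff[OF q(2) pos(1)] by blast
qed

lemma packing_norm_dominated_single:
  assumes "1 \<le> q" "q \<noteq> \<infinity>" "1 \<le> p" "p \<noteq> \<infinity>" "packing_norm p l R S k' \<mu> < \<infinity>" "0 \<le> M"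
    and dom: "\<And>c r xs. R \<le> r \<Longrightarrow> r \<le> S \<Longrightarrow> xs \<in> tuples k c r \<Longrightarrow>
      \<exists>us\<in>tuples k' c r. \<bar>\<kappa> xs\<bar> powr enn2real q \<le> M * \<bar>\<mu> us\<bar> powr enn2real p"
  shows "packing_norm q l R S k \<kappa> < \<infinity>"
proof (rule packing_norm_dominated[OF assms(1-4,3-5,5,6)])
  fix c :: 'a and r :: real and xs assume "R \<le> r" "r \<le> S" "xs \<in> tuples k c r"
  then obtain us where us: "us \<in> tuples k' c r"
      "\<bar>\<kappa> xs\<bar> powr enn2real q \<le> M * \<bar>\<mu> us\<bar> powr enn2real p"
    using dom by blast
  moreover have "M * \<bar>\<mu> us\<bar> powr enn2real p \<le> M * (\<bar>\<mu> us\<bar> powr enn2real p + \<bar>\<mu> us\<bar> powr enn2real p)"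
    using \<open>0 \<le> M\<close> by (intro mult_left_mono) auto
  ultimately show "\<exists>us\<in>tuples k' c r. \<exists>vs\<in>tuples k' c r. \<bar>\<kappa> xs\<bar> powr enn2real q \<le>
      M * (\<bar>\<mu> us\<bar> powr enn2real p + \<bar>\<mu> vs\<bar> powr enn2real p)"
    by (meson order_trans)
qed

section \<open>Linear operations and comparison of exponents\<close>

lemma powr_abs_add_le:
  fixes a b p :: real
  assumes "0 < p"
  shows "\<bar>a + b\<bar> powr p \<le> 2 powr p * (\<bar>a\<bar> powr p + \<bar>b\<bar> powr p)"
proof -
  \<comment> \<open>Replacing both summands by the larger one costs the factor
    \<open>2 powr p\<close>, which is harmless for finiteness; this stands in for Minkowski's
    inequality.\<close>
  have "\<bar>a + b\<bar> powr p \<le> (2 * max \<bar>a\<bar> \<bar>b\<bar>) powr p"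
    using assms by (intro powr_mono2) auto
  also have "\<dots> = 2 powr p * (max \<bar>a\<bar> \<bar>b\<bar>) powr p"
    by (simp add: powr_mult)
  also have "\<dots> \<le> 2 powr p * (\<bar>a\<bar> powr p + \<bar>b\<bar> powr p)"
    by (intro mult_left_mono) (auto simp: max_def)
  finally show ?thesis .
qed

lemma packing_norm_add:
  assumes "1 \<le> p" "packing_norm p l R S k \<kappa> < \<infinity>" "packing_norm p l R S k \<mu> < \<infinity>"
  shows "packing_norm p l R S k (\<lambda>xs. \<kappa> xs + \<mu> xs) < \<infinity>"
proof (cases "p = \<infinity>")
  case True
  obtain C D where "\<And>c r xs. R \<le> r \<Longrightarrow> r \<le> S \<Longrightarrow> xs \<in> tuples k c r \<Longrightarrow> \<bar>\<kappa> xs\<bar> \<le> C"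
    "\<And>c r xs. R \<le> r \<Longrightarrow> r \<le> S \<Longrightarrow> xs \<in> tuples k c r \<Longrightarrow> \<bar>\<mu> xs\<bar> \<le> D"
    using assms unfolding True packing_norm_infinite_less_top_iff by blast
  then have "\<bar>\<kappa> xs + \<mu> xs\<bar> \<le> C + D" if "R \<le> r" "r \<le> S" "xs \<in> tuples k c r" for c r xs
    using that by (intro order_trans[OF abs_triangle_ineq] add_mono)
  then show ?thesis unfolding True packing_norm_infinite_less_top_iff by blast
next
  case False
  have p: "0 < enn2real p" using finite_exponent[OF assms(1) False] by simp
  show ?thesis
  proof (rule packing_norm_dominated[OF assms(1) False assms(1) False assms(1) False assms(2,3)])
    fix c :: 'a and r :: real and xs assume "xs \<in> tuples k c r"
    then show "\<exists>us\<in>tuples k c r. \<exists>vs\<in>tuples k c r. \<bar>\<kappa> xs + \<mu> xs\<bar> powr enn2real p \<le>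
        2 powr enn2real p * (\<bar>\<kappa> us\<bar> powr enn2real p + \<bar>\<mu> vs\<bar> powr enn2real p)"
      using powr_abs_add_le[OF p] by blast
  qed simp
qed

lemma packing_norm_scale:
  assumes "1 \<le> p" "packing_norm p l R S k \<kappa> < \<infinity>"
  shows "packing_norm p l R S k (\<lambda>xs. a * \<kappa> xs) < \<infinity>"
proof (cases "p = \<infinity>")
  case True
  obtain C where "\<And>c r xs. R \<le> r \<Longrightarrow> r \<le> S \<Longrightarrow> xs \<in> tuples k c r \<Longrightarrow> \<bar>\<kappa> xs\<bar> \<le> C"
    using assms unfolding True packing_norm_infinite_less_top_iff by blast
  then have "\<bar>a * \<kappa> xs\<bar> \<le> \<bar>a\<bar> * C" if "R \<le> r" "r \<le> S" "xs \<in> tuples k c r" for c r xs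
    using that by (simp add: abs_mult mult_left_mono)
  then show ?thesis unfolding True packing_norm_infinite_less_top_iff by blast
next
  case False
  show ?thesis
  proof (rule packing_norm_dominated_single[OF assms(1) False assms(1) False assms(2)])
    fix c :: 'a and r :: real and xs assume "xs \<in> tuples k c r"
    then show "\<exists>us\<in>tuples k c r. \<bar>a * \<kappa> xs\<bar> powr enn2real p \<le>
        \<bar>a\<bar> powr enn2real p * \<bar>\<kappa> us\<bar> powr enn2real p"
      by (auto simp: abs_mult powr_mult)
  qed simp
qed

lemma packing_norm_zero: "packing_norm p l R S k (\<lambda>_ :: 'a::metric_space list. 0) = 0"
proof (cases "p = \<infinity>")
  case True
  have "packing_norm p l R S k (\<lambda>_ :: 'a list. 0) \<le> 0"
    unfolding True packing_norm_infinite
    by (intro SUP_least) (auto simp del: le_zero_eq intro!: SUP_least)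
  then show ?thesis by simp
next
  case False
  have "local_sup (enn2real p) k (\<lambda>_ :: 'a list. 0) (c, r) \<le> 0" for c r
    unfolding local_sup_def prod.case by (intro SUP_least) simp
  then have "local_sup (enn2real p) k (\<lambda>_ :: 'a list. 0) = (\<lambda>_. 0)"
    by (auto simp: fun_eq_iff)
  then have "infsum (local_sup (enn2real p) k (\<lambda>_ :: 'a list. 0)) P = 0" for P :: "('a \<times> real) set"
    by (simp add: infsum_0)
  then have "packing_norm p l R S k (\<lambda>_ :: 'a list. 0) \<le> 0"
    unfolding packing_norm_finite[OF False] by (intro SUP_least) (simp add: ennreal_powr_def)
  then show ?thesis by simp
qed

text \<open>The inclusion of l^p into l^q: once all values are bounded by \<open>C\<close>, a q-th
  power is at most C^(q-p) times the p-th power.\<close>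

lemma packing_norm_antimono_exponent:
  assumes "1 \<le> p" "p \<le> q" "packing_norm p l R S k \<kappa> < \<infinity>"
  shows "packing_norm q l R S k \<kappa> < \<infinity>"
proof -
  obtain C where "0 \<le> C"
    and C: "\<And>c r xs. R \<le> r \<Longrightarrow> r \<le> S \<Longrightarrow> xs \<in> tuples k c r \<Longrightarrow> \<bar>\<kappa> xs\<bar> \<le> C"
    using packing_norm_bounded[OF assms(3,1)] by blast
  show ?thesis
  proof (cases "q = \<infinity>")
    case True
    then show ?thesis using C unfolding True packing_norm_infinite_less_top_iff by blast
  next
    case False
    then have "p \<noteq> \<infinity>" using assms(2) by (auto simp: top_unique)
    define s t where "s = enn2real p" and "t = enn2real q"
    have st: "1 \<le> s" "s \<le> t"
      using assms \<open>p \<noteq> \<infinity>\<close> False finite_exponent by (auto simp: s_def t_def less_top intro: enn2real_mono)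
    have "\<bar>\<kappa> xs\<bar> powr t \<le> C powr (t - s) * \<bar>\<kappa> xs\<bar> powr s"
      if "R \<le> r" "r \<le> S" "xs \<in> tuples k c r" for c r xs
    proof -
      \<comment> \<open>This holds at a zero value even if \<open>t = s\<close>, because
        \<open>0 powr a = 0\<close> for every \<open>a\<close>.\<close>
      have "\<bar>\<kappa> xs\<bar> powr t = \<bar>\<kappa> xs\<bar> powr (t - s) * \<bar>\<kappa> xs\<bar> powr s"
        by (simp flip: powr_add)
      also have "\<dots> \<le> C powr (t - s) * \<bar>\<kappa> xs\<bar> powr s"
        using st C[OF that] by (intro mult_mono powr_mono2) auto
      finally show ?thesis .
    qed
    moreover have "1 \<le> q" using assms by simp
    ultimately show ?thesis
      using assms False \<open>p \<noteq> \<infinity>\<close> unfolding s_def t_def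
      by (intro packing_norm_dominated_single[where p = p and \<mu> = \<kappa> and k' = k,
            OF _ False assms(1) _ assms(3) powr_ge_zero]) blast+
  qed
qed

section \<open>Pointwise estimates for products\<close>

lemma young_max:
  fixes a b p p' q :: real
  assumes "0 \<le> a" "0 \<le> b" "0 < p" "0 < p'" "0 < q" "1 / p + 1 / p' = 1 / q"
  shows "(a * b) powr q \<le> a powr p + b powr p'"
proof -
  \<comment> \<open>The larger of the two powers bounds the product on its own: \<open>a\<close> is
    at most \<open>b powr (p' / p)\<close>, and \<open>(p' / p + 1) * q\<close> equals
    \<open>p'\<close>. The opposite case follows by symmetry.\<close>
  have *: "(a * b) powr q \<le> b powr p'"
    if "0 \<le> a" "0 \<le> b" "0 < p" "0 < p'" "1 / p + 1 / p' = 1 / q" "a powr p \<le> b powr p'"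
    for a b p p' :: real
  proof -
    have "(a powr p) powr (1 / p) \<le> (b powr p') powr (1 / p)"
      using that by (intro powr_mono2) auto
    then have "a \<le> b powr (p' / p)"
      using that by (simp add: powr_powr)
    then have "(a * b) powr q \<le> (b powr (p' / p) * b powr 1) powr q"
      using that assms by (intro powr_mono2 mult_mono) auto
    also have "\<dots> = b powr ((p' / p + 1) * q)"
      by (simp only: powr_powr flip: powr_add)
    also have "(p' / p + 1) * q = p' * (1 / p + 1 / p') * q"
      using that(4) by (simp add: distrib_left)
    also have "\<dots> = p'"
      unfolding that(5) using assms by simp
    finally show ?thesis .
  qed
  show ?thesis
  proof (cases "a powr p \<le> b powr p'")
    case True
    then show ?thesis using *[of a b p p'] assms by (simp add: add_increasing)
  next
    case False
    then show ?thesis using *[of b a p' p] assms by (simp add: add_increasing2 mult.commute add.commute)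
  qed
qed

lemma inverse_exponent:
  assumes "1 \<le> p" "p \<noteq> (\<infinity> :: ennreal)"
  shows "inverse p = ennreal (1 / enn2real p)"
  using assms by (cases p) (simp_all add: inverse_ennreal inverse_eq_divide)

lemma inverse_exponent_inj:
  assumes "1 \<le> p" "1 \<le> q" "inverse p = inverse (q :: ennreal)"
  shows "p = q"
proof (cases "p = \<infinity>")
  case True
  then show ?thesis using assms ennreal_inverse_eq_0_iff[of q] by simp
next
  case False
  then have "q \<noteq> \<infinity>" using assms ennreal_inverse_eq_0_iff[of p] by auto
  with False show ?thesis
    using assms by (cases p; cases q) (auto simp: inverse_ennreal)
qed

text \<open>Only finiteness is needed, so Hoelder's inequality can be replaced by a pointwise one.\<close>

lemma packing_norm_product:
  assumes p: "1 \<le> p" and p': "1 \<le> p'" and q: "1 \<le> q"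
    and pq: "inverse p + inverse p' = inverse q"
    and \<kappa>: "packing_norm p l R S k \<kappa> < \<infinity>" and \<mu>: "packing_norm p' l R S k' \<mu> < \<infinity>"
    and dom: "\<And>c r xs. R \<le> r \<Longrightarrow> r \<le> S \<Longrightarrow> xs \<in> tuples m c r \<Longrightarrow>
      \<exists>us\<in>tuples k c r. \<exists>vs\<in>tuples k' c r. \<bar>\<nu> xs\<bar> \<le> \<bar>\<kappa> us\<bar> * \<bar>\<mu> vs\<bar>"
  shows "packing_norm q l R S m \<nu> < \<infinity>"
proof -
  obtain C where "0 \<le> C"
    and C: "\<And>c r xs. R \<le> r \<Longrightarrow> r \<le> S \<Longrightarrow> xs \<in> tuples k c r \<Longrightarrow> \<bar>\<kappa> xs\<bar> \<le> C"
    using packing_norm_bounded[OF \<kappa> p] by blast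
  obtain D where "0 \<le> D"
    and D: "\<And>c r xs. R \<le> r \<Longrightarrow> r \<le> S \<Longrightarrow> xs \<in> tuples k' c r \<Longrightarrow> \<bar>\<mu> xs\<bar> \<le> D"
    using packing_norm_bounded[OF \<mu> p'] by blast
  show ?thesis
  proof (cases "q = \<infinity>")
    case True
    have "\<bar>\<nu> xs\<bar> \<le> C * D" if r: "R \<le> r" "r \<le> S" "xs \<in> tuples m c r" for c r xs
    proof -
      obtain us vs where uv: "us \<in> tuples k c r" "vs \<in> tuples k' c r" "\<bar>\<nu> xs\<bar> \<le> \<bar>\<kappa> us\<bar> * \<bar>\<mu> vs\<bar>"
        using dom[OF r] by blast
      then show ?thesis
        using C[OF r(1,2) uv(1)] D[OF r(1,2) uv(2)] \<open>0 \<le> C\<close>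
        by (meson abs_ge_zero mult_mono order_trans)
    qed
    then show ?thesis unfolding True packing_norm_infinite_less_top_iff by blast
  next
    case False
    note q' = finite_exponent[OF q False]
    show ?thesis
    proof (cases "p = \<infinity>")
      case True
      \<comment> \<open>An infinite exponent has reciprocal 0, so the other factor has the exponent
        of the product, and \<open>\<kappa>\<close> enters only through its bound
        \<open>C\<close>.\<close>
      then have "inverse p' = inverse q" using pq by simp
      then have [simp]: "p' = q" using inverse_exponent_inj p p' q by blast
      have dom': "\<exists>vs\<in>tuples k' c r. \<bar>\<nu> xs\<bar> powr enn2real q \<le>
          C powr enn2real q * \<bar>\<mu> vs\<bar> powr enn2real q"
        if r: "R \<le> r" "r \<le> S" "xs \<in> tuples m c r" for c r xs
      proof -
        obtain us vs where uv: "us \<in> tuples k c r" "vs \<in> tuples k' c r" "\<bar>\<nu> xs\<bar> \<le> \<bar>\<kappa> us\<bar> * \<bar>\<mu> vs\<bar>"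
          using dom[OF r] by blast
        have "\<bar>\<nu> xs\<bar> \<le> C * \<bar>\<mu> vs\<bar>"
          using uv(3) C[OF r(1,2) uv(1)] by (meson abs_ge_zero mult_right_mono order_trans)
        then have "\<bar>\<nu> xs\<bar> powr enn2real q \<le> (C * \<bar>\<mu> vs\<bar>) powr enn2real q"
          using q' by (intro powr_mono2) auto
        also have "\<dots> = C powr enn2real q * \<bar>\<mu> vs\<bar> powr enn2real q"
          using \<open>0 \<le> C\<close> by (simp add: powr_mult)
        finally show ?thesis using uv(2) by blast
      qed
      show ?thesis
      proof (rule packing_norm_dominated_single[OF q False q False _ powr_ge_zero])
        show "packing_norm q l R S k' \<mu> < \<infinity>" using \<mu> by simp
      qed (rule dom')
    next
      case pfin: False
      show ?thesis
      proof (cases "p' = \<infinity>")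
        case True
        then have "inverse p = inverse q" using pq by simp
        then have [simp]: "p = q" using inverse_exponent_inj p p' q by blast
        have dom': "\<exists>vs\<in>tuples k c r. \<bar>\<nu> xs\<bar> powr enn2real q \<le>
            D powr enn2real q * \<bar>\<kappa> vs\<bar> powr enn2real q"
          if r: "R \<le> r" "r \<le> S" "xs \<in> tuples m c r" for c r xs
        proof -
          obtain us vs where uv: "us \<in> tuples k c r" "vs \<in> tuples k' c r" "\<bar>\<nu> xs\<bar> \<le> \<bar>\<kappa> us\<bar> * \<bar>\<mu> vs\<bar>"
            using dom[OF r] by blast
          have "\<bar>\<nu> xs\<bar> \<le> \<bar>\<kappa> us\<bar> * D"
            using uv(3) D[OF r(1,2) uv(2)] by (meson abs_ge_zero mult_left_mono order_trans)
          then have "\<bar>\<nu> xs\<bar> powr enn2real q \<le> (D * \<bar>\<kappa> us\<bar>) powr enn2real q"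
            using q' by (intro powr_mono2) (auto simp: mult.commute)
          also have "\<dots> = D powr enn2real q * \<bar>\<kappa> us\<bar> powr enn2real q"
            using \<open>0 \<le> D\<close> by (simp add: powr_mult)
          finally show ?thesis using uv(1) by blast
        qed
          show ?thesis
      proof (rule packing_norm_dominated_single[OF q False q False _ powr_ge_zero])
        show "packing_norm q l R S k \<kappa> < \<infinity>" using \<kappa> by simp
      qed (rule dom')
      next
        case p'fin: False
        note p0 = finite_exponent[OF p pfin] and p'0 = finite_exponent[OF p' p'fin]
        have "ennreal (1 / enn2real p + 1 / enn2real p') = ennreal (1 / enn2real q)"
          using pq p0 p'0 by (simp add: inverse_exponent[OF p pfin]
              inverse_exponent[OF p' p'fin] inverse_exponent[OF q False])
        then have rel: "1 / enn2real p + 1 / enn2real p' = 1 / enn2real q"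
          using p0 p'0 q' by (subst (asm) ennreal_inj) auto
        have dom': "\<exists>us\<in>tuples k c r. \<exists>vs\<in>tuples k' c r. \<bar>\<nu> xs\<bar> powr enn2real q \<le>
            1 * (\<bar>\<kappa> us\<bar> powr enn2real p + \<bar>\<mu> vs\<bar> powr enn2real p')"
          if r: "R \<le> r" "r \<le> S" "xs \<in> tuples m c r" for c r xs
        proof -
          obtain us vs where uv: "us \<in> tuples k c r" "vs \<in> tuples k' c r" "\<bar>\<nu> xs\<bar> \<le> \<bar>\<kappa> us\<bar> * \<bar>\<mu> vs\<bar>"
            using dom[OF r] by blast
          have "\<bar>\<nu> xs\<bar> powr enn2real q \<le> (\<bar>\<kappa> us\<bar> * \<bar>\<mu> vs\<bar>) powr enn2real q"
            using uv(3) q' by (intro powr_mono2) auto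
          also have "\<dots> \<le> \<bar>\<kappa> us\<bar> powr enn2real p + \<bar>\<mu> vs\<bar> powr enn2real p'"
            using rel p0 p'0 q' by (intro young_max) auto
          finally show ?thesis using uv(1,2) by auto
        qed
        show ?thesis
          by (rule packing_norm_dominated[OF q False p pfin p' p'fin \<kappa> \<mu> zero_le_one]) (rule dom')
      qed
    qed
  qed
qed

section \<open>Transport of norms along packings\<close>

definition packing_map :: "('a::metric_space \<Rightarrow> 'b::metric_space) \<Rightarrow>
    real \<Rightarrow> real \<Rightarrow> real \<Rightarrow> real \<Rightarrow> real \<Rightarrow> real \<Rightarrow> bool" where
  "packing_map \<phi> l' R' S' l R S \<longleftrightarrow> (\<forall>P\<in>packings l R S.
     inj_on (\<lambda>(c, r). (\<phi> c, R')) P \<and> (\<lambda>(c, r). (\<phi> c, R')) ` P \<in> packings l' R' S')"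

text \<open>Distinct balls stay distinct, so the sum over a packing is reindexed without loss and
  the constant is 1 for every exponent. The degrees \<open>k\<close> and \<open>k'\<close> may
  differ because the homotopy compares a cochain with one of the next degree.\<close>

lemma packing_norm_transfer:
  assumes pm: "packing_map \<phi> l' R' S' l R S"
    and dom: "\<And>c r xs. R \<le> r \<Longrightarrow> r \<le> S \<Longrightarrow> xs \<in> tuples k c r \<Longrightarrow>
      \<exists>zs\<in>tuples k' (\<phi> c) R'. \<bar>\<kappa> xs\<bar> \<le> \<bar>\<kappa>' zs\<bar>"
  shows "packing_norm p l R S k \<kappa> \<le> packing_norm p l' R' S' k' \<kappa>'"
proof (cases "p = \<infinity>")
  case True
  show ?thesis
    unfolding True packing_norm_infinite
  proof (rule SUP_least, rule SUP_least, clarify, rule SUP_least)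
    fix P :: "('a \<times> real) set" and c r xs
    assume P: "P \<in> packings l R S" "(c, r) \<in> P" and xs: "xs \<in> tuples k c r"
    obtain zs where zs: "zs \<in> tuples k' (\<phi> c) R'" "\<bar>\<kappa> xs\<bar> \<le> \<bar>\<kappa>' zs\<bar>"
      using dom packings_radius[OF P] xs by blast
    let ?Q = "(\<lambda>(c, r). (\<phi> c, R')) ` P"
    have Q: "?Q \<in> packings l' R' S'" using pm P(1) by (auto simp: packing_map_def)
    have "ennreal \<bar>\<kappa> xs\<bar> \<le> ennreal \<bar>\<kappa>' zs\<bar>" using zs(2) by (rule ennreal_leI)
    also have "\<dots> \<le> (SUP zs\<in>tuples k' (\<phi> c) R'. ennreal \<bar>\<kappa>' zs\<bar>)"
      using zs(1) by (rule SUP_upper)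
    also have "\<dots> = (case (\<phi> c, R') of (c, r) \<Rightarrow> SUP xs\<in>tuples k' c r. ennreal \<bar>\<kappa>' xs\<bar>)"
      by simp
    also have "\<dots> \<le> (SUP (c, r)\<in>?Q. SUP xs\<in>tuples k' c r. ennreal \<bar>\<kappa>' xs\<bar>)"
      using P(2) by (intro SUP_upper) force
    also have "\<dots> \<le> (SUP P\<in>packings l' R' S'. SUP (c, r)\<in>P. SUP xs\<in>tuples k' c r. ennreal \<bar>\<kappa>' xs\<bar>)"
      by (rule SUP_upper[OF Q])
    finally show "ennreal \<bar>\<kappa> xs\<bar> \<le> \<dots>" .
  qed
next
  case False
  let ?s = "local_sup (enn2real p) k \<kappa>" and ?s' = "local_sup (enn2real p) k' \<kappa>'"
  show ?thesis
    unfolding packing_norm_finite[OF False]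
  proof (rule SUP_least)
    fix P :: "('a \<times> real) set" assume P: "P \<in> packings l R S"
    let ?h = "\<lambda>(c, r). (\<phi> c, R')"
    have Q: "?h ` P \<in> packings l' R' S'" "inj_on ?h P"
      using pm P(1) by (auto simp: packing_map_def)
    have "?s (c, r) \<le> ?s' (\<phi> c, R')" if cr: "(c, r) \<in> P" for c r
      unfolding local_sup_def[of _ k] prod.case
    proof (rule SUP_least)
      fix xs assume "xs \<in> tuples k c r"
      then obtain zs where zs: "zs \<in> tuples k' (\<phi> c) R'" "\<bar>\<kappa> xs\<bar> \<le> \<bar>\<kappa>' zs\<bar>"
        using dom packings_radius[OF P cr] by blast
      have "ennreal (\<bar>\<kappa> xs\<bar> powr enn2real p) \<le> ennreal (\<bar>\<kappa>' zs\<bar> powr enn2real p)"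
        using zs(2) by (intro ennreal_leI powr_mono2) auto
      also have "\<dots> \<le> ?s' (\<phi> c, R')" by (rule local_sup_upper[OF zs(1)])
      finally show "ennreal (\<bar>\<kappa> xs\<bar> powr enn2real p) \<le> ?s' (\<phi> c, R')" .
    qed
    then have "infsum ?s P \<le> infsum (?s' \<circ> ?h) P"
      by (intro infsum_mono nonneg_summable_on_complete) auto
    also have "\<dots> = infsum ?s' (?h ` P)"
      by (rule infsum_reindex[OF Q(2), symmetric])
    finally have "ennreal_powr (infsum ?s P) (1 / enn2real p) \<le>
        ennreal_powr (infsum ?s' (?h ` P)) (1 / enn2real p)"
      by (intro ennreal_powr_mono) auto
    also have "\<dots> \<le> (SUP P\<in>packings l' R' S'. ennreal_powr (infsum ?s' P) (1 / enn2real p))"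
      by (rule SUP_upper[OF Q(1)])
    finally show "ennreal_powr (infsum ?s P) (1 / enn2real p) \<le> \<dots>" .
  qed
qed

section \<open>Packing cohomology and its cup-product\<close>

text \<open>The restriction common to \<open>coboundary\<close>, \<open>pull_cochain\<close> and
  \<open>cup_cochain\<close>, separated from the formulas being restricted so that identities for
  arbitrary functions on lists apply to them.\<close>

definition on_simplices :: "real \<Rightarrow> nat \<Rightarrow> 'a::metric_space cochain \<Rightarrow> 'a cochain" where
  "on_simplices S k \<phi> = (\<lambda>xs. if rips_simplex S k xs then \<phi> xs else 0)"

lemma rips_simplex_length: "rips_simplex S k xs \<Longrightarrow> length xs = Suc k"
  by (simp add: rips_simplex_def)

lemma rips_simplex_subset:
  assumes "rips_simplex S n xs" "set ys \<subseteq> set xs" "distinct ys" "length ys = Suc k"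
  shows "rips_simplex S k ys"
  using assms unfolding rips_simplex_def by blast

lemma rips_simplex_omit:
  assumes "rips_simplex S (Suc k) xs" "i < length xs"
  shows "rips_simplex S k (omit i xs)"
proof (rule rips_simplex_subset[OF assms(1)])
  show "set (omit i xs) \<subseteq> set xs"
    by (auto dest: in_set_takeD in_set_dropD)
  show "distinct (omit i xs)"
    using assms by (auto simp: rips_simplex_def set_take_disj_set_drop_if_distinct)
  show "length (omit i xs) = Suc k"
    using assms by (simp add: rips_simplex_def)
qed

lemma rips_simplex_permute:
  "\<sigma> permutes {..<length xs} \<Longrightarrow> rips_simplex S k (permute_list \<sigma> xs) \<longleftrightarrow> rips_simplex S k xs"
  by (simp add: rips_simplex_def)

lemma rips_simplex_take:
  assumes "rips_simplex S (k + k') xs"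
  shows "rips_simplex S k (take (Suc k) xs)"
  by (rule rips_simplex_subset[OF assms])
    (use assms in \<open>auto simp: rips_simplex_def dest: in_set_takeD\<close>)

lemma rips_simplex_drop:
  assumes "rips_simplex S (k + k') xs"
  shows "rips_simplex S k' (drop k xs)"
  by (rule rips_simplex_subset[OF assms])
    (use assms in \<open>auto simp: rips_simplex_def dest: in_set_dropD\<close>)

lemma coboundary_eq: "coboundary S k \<kappa> = on_simplices S (Suc k) (delta \<kappa>)"
  by (auto simp: coboundary_def on_simplices_def delta_eq_sum fun_eq_iff lessThan_Suc_atMost
      dest!: rips_simplex_length)

lemma pull_cochain_eq: "pull_cochain f S k \<kappa> = on_simplices S k (\<lambda>xs. \<kappa> (map f xs))"
  by (simp add: pull_cochain_def on_simplices_def)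

lemma cup_cochain_eq: "cup_cochain S k k' \<kappa> \<mu> = on_simplices S (k + k') (alt (raw_cup k \<kappa> \<mu>))"
  by (auto simp: cup_cochain_def on_simplices_def alt_def raw_cup_def fun_eq_iff
      dest!: rips_simplex_length)

text \<open>Faces of a simplex are simplices, so restricting \<open>\<phi>\<close> beforehand
  changes no face value.\<close>

lemma coboundary_on_simplices:
  "coboundary S k (on_simplices S k \<phi>) = on_simplices S (Suc k) (delta \<phi>)"
  by (auto simp: coboundary_eq on_simplices_def rips_simplex_omit fun_eq_iff intro!: delta_cong)

lemma AS_cochains_iff:
  "\<kappa> \<in> AS_cochains S k \<longleftrightarrow> (\<forall>xs. \<not> rips_simplex S k xs \<longrightarrow> \<kappa> xs = 0) \<and> skew (Suc k) \<kappa>"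
  by (simp add: AS_cochains_def skew_def)

lemma on_simplices_in_AS_cochains:
  "skew (Suc k) \<phi> \<Longrightarrow> on_simplices S k \<phi> \<in> AS_cochains S k"
  unfolding AS_cochains_iff skew_def on_simplices_def by (auto simp: rips_simplex_permute)

section \<open>Linear structure on cochains and on cohomology classes\<close>

lemma coboundary_add:
  "coboundary S k (\<lambda>xs. \<kappa> xs + \<mu> xs) = (\<lambda>xs. coboundary S k \<kappa> xs + coboundary S k \<mu> xs)"
  by (simp add: coboundary_eq on_simplices_def delta_add fun_eq_iff)

lemma coboundary_scale:
  "coboundary S k (\<lambda>xs. a * \<kappa> xs) = (\<lambda>xs. a * coboundary S k \<kappa> xs)"
  by (simp add: coboundary_eq on_simplices_def delta_cmult fun_eq_iff)

lemma coboundary_zero: "coboundary S k (\<lambda>_. 0) = (\<lambda>_. 0)"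
  using coboundary_scale[of S k 0 "\<lambda>_. 0"] by simp

lemma AL_space_zero: "(\<lambda>_. 0) \<in> AL_space p l R S k"
  by (simp add: AL_space_def AS_cochains_def packing_norm_zero)

lemma AL_space_add:
  assumes "1 \<le> p" "\<kappa> \<in> AL_space p l R S k" "\<mu> \<in> AL_space p l R S k"
  shows "(\<lambda>xs. \<kappa> xs + \<mu> xs) \<in> AL_space p l R S k"
  using assms packing_norm_add[OF assms(1)]
  by (auto simp: AL_space_def AS_cochains_def algebra_simps)

lemma AL_space_scale:
  assumes "1 \<le> p" "\<kappa> \<in> AL_space p l R S k"
  shows "(\<lambda>xs. a * \<kappa> xs) \<in> AL_space p l R S k"
  using assms packing_norm_scale[OF assms(1)]
  by (auto simp: AL_space_def AS_cochains_def algebra_simps)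

lemma AL_complex_zero: "(\<lambda>_. 0) \<in> AL_complex \<pi> l R S k"
  by (simp add: AL_complex_def coboundary_zero AL_space_zero)

lemma AL_complex_add:
  assumes "exponents \<pi>" "\<kappa> \<in> AL_complex \<pi> l R S k" "\<mu> \<in> AL_complex \<pi> l R S k"
  shows "(\<lambda>xs. \<kappa> xs + \<mu> xs) \<in> AL_complex \<pi> l R S k"
  using assms by (simp add: AL_complex_def coboundary_add AL_space_add exponents_def)

lemma AL_complex_scale:
  assumes "exponents \<pi>" "\<kappa> \<in> AL_complex \<pi> l R S k"
  shows "(\<lambda>xs. a * \<kappa> xs) \<in> AL_complex \<pi> l R S k"
  using assms by (simp add: AL_complex_def coboundary_scale AL_space_scale exponents_def)

lemma AL_cocycles_iff:
  "\<kappa> \<in> AL_cocycles \<pi> l R S k \<longleftrightarrow> \<kappa> \<in> AL_space (\<pi> k) l R S k \<and> coboundary S k \<kappa> = (\<lambda>_. 0)"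
  by (auto simp: AL_cocycles_def AL_complex_def AL_space_zero)

lemma AL_cocycles_add:
  assumes "exponents \<pi>" "\<kappa> \<in> AL_cocycles \<pi> l R S k" "\<mu> \<in> AL_cocycles \<pi> l R S k"
  shows "(\<lambda>xs. \<kappa> xs + \<mu> xs) \<in> AL_cocycles \<pi> l R S k"
  using assms by (simp add: AL_cocycles_iff coboundary_add AL_space_add exponents_def)

lemma AL_cocycles_scale:
  assumes "exponents \<pi>" "\<kappa> \<in> AL_cocycles \<pi> l R S k"
  shows "(\<lambda>xs. a * \<kappa> xs) \<in> AL_cocycles \<pi> l R S k"
  using assms by (simp add: AL_cocycles_iff coboundary_scale AL_space_scale exponents_def)

lemma AL_coboundaries_zero: "(\<lambda>_. 0) \<in> AL_coboundaries \<pi> l R S k"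
  by (cases k) (auto intro!: image_eqI[of _ _ "\<lambda>_. 0"] simp: coboundary_zero AL_complex_zero)

lemma AL_coboundaries_add:
  assumes "exponents \<pi>" "\<kappa> \<in> AL_coboundaries \<pi> l R S k" "\<mu> \<in> AL_coboundaries \<pi> l R S k"
  shows "(\<lambda>xs. \<kappa> xs + \<mu> xs) \<in> AL_coboundaries \<pi> l R S k"
proof (cases k)
  case 0
  then show ?thesis using assms by simp
next
  case (Suc j)
  then obtain \<alpha> \<beta> where "\<alpha> \<in> AL_complex \<pi> l R S j" "\<beta> \<in> AL_complex \<pi> l R S j"
    "\<kappa> = coboundary S j \<alpha>" "\<mu> = coboundary S j \<beta>"
    using assms by auto
  then show ?thesis
    using Suc AL_complex_add[OF assms(1), of \<alpha> l R S j \<beta>] by (auto simp flip: coboundary_add)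
qed

lemma AL_coboundaries_scale:
  assumes "exponents \<pi>" "\<kappa> \<in> AL_coboundaries \<pi> l R S k"
  shows "(\<lambda>xs. a * \<kappa> xs) \<in> AL_coboundaries \<pi> l R S k"
proof (cases k)
  case 0
  then show ?thesis using assms by simp
next
  case (Suc j)
  then obtain \<alpha> where "\<alpha> \<in> AL_complex \<pi> l R S j" "\<kappa> = coboundary S j \<alpha>"
    using assms by auto
  then show ?thesis
    using Suc AL_complex_scale[OF assms(1), of \<alpha> l R S j a] by (auto simp flip: coboundary_scale)
qed

lemma cohomologousI:
  assumes "\<kappa> \<in> AL_cocycles \<pi> l R S k" "\<mu> \<in> AL_cocycles \<pi> l R S k"
    and "\<beta> \<in> AL_coboundaries \<pi> l R S k" "\<And>xs. \<kappa> xs - \<mu> xs = \<beta> xs"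
  shows "(\<kappa>, \<mu>) \<in> cohomologous \<pi> l R S k"
  using assms by (simp add: cohomologous_def)

lemma cohomologousD:
  assumes "(\<kappa>, \<mu>) \<in> cohomologous \<pi> l R S k"
  shows "\<kappa> \<in> AL_cocycles \<pi> l R S k" "\<mu> \<in> AL_cocycles \<pi> l R S k"
    "(\<lambda>xs. \<kappa> xs - \<mu> xs) \<in> AL_coboundaries \<pi> l R S k"
  using assms by (simp_all add: cohomologous_def)

lemma cohomologous_add:
  assumes "exponents \<pi>" "(\<kappa>, \<kappa>') \<in> cohomologous \<pi> l R S k" "(\<mu>, \<mu>') \<in> cohomologous \<pi> l R S k"
  shows "(\<lambda>xs. \<kappa> xs + \<mu> xs, \<lambda>xs. \<kappa>' xs + \<mu>' xs) \<in> cohomologous \<pi> l R S k"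
  by (rule cohomologousI[OF _ _ AL_coboundaries_add[OF assms(1)
          cohomologousD(3)[OF assms(2)] cohomologousD(3)[OF assms(3)]]])
    (use cohomologousD[OF assms(2)] cohomologousD[OF assms(3)] in
      \<open>simp_all add: AL_cocycles_add[OF assms(1)]\<close>)

lemma cohomologous_scale:
  assumes "exponents \<pi>" "(\<kappa>, \<kappa>') \<in> cohomologous \<pi> l R S k"
  shows "(\<lambda>xs. a * \<kappa> xs, \<lambda>xs. a * \<kappa>' xs) \<in> cohomologous \<pi> l R S k"
  by (rule cohomologousI[OF _ _ AL_coboundaries_scale[OF assms(1) cohomologousD(3)[OF assms(2)]]])
    (use cohomologousD[OF assms(2)] in
      \<open>simp_all add: AL_cocycles_scale[OF assms(1)] right_diff_distrib\<close>)

lemma cohomologous_trans: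
  assumes "exponents \<pi>" "(\<kappa>, \<mu>) \<in> cohomologous \<pi> l R S k" "(\<mu>, \<nu>) \<in> cohomologous \<pi> l R S k"
  shows "(\<kappa>, \<nu>) \<in> cohomologous \<pi> l R S k"
  by (rule cohomologousI[OF cohomologousD(1)[OF assms(2)] cohomologousD(2)[OF assms(3)]
        AL_coboundaries_add[OF assms(1) cohomologousD(3)[OF assms(2)] cohomologousD(3)[OF assms(3)]]])
    simp

lemma equiv_cohomologous:
  assumes "exponents \<pi>"
  shows "equiv (AL_cocycles \<pi> l R S k) (cohomologous \<pi> l R S k)"
proof (rule equivI)
  show "cohomologous \<pi> l R S k \<subseteq> AL_cocycles \<pi> l R S k \<times> AL_cocycles \<pi> l R S k"
    by (auto dest: cohomologousD)
  show "refl_on (AL_cocycles \<pi> l R S k) (cohomologous \<pi> l R S k)"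
    by (auto intro!: refl_onI cohomologousI[OF _ _ AL_coboundaries_zero])
  show "sym (cohomologous \<pi> l R S k)"
  proof (rule symI)
    fix \<kappa> \<mu> assume *: "(\<kappa>, \<mu>) \<in> cohomologous \<pi> l R S k"
    show "(\<mu>, \<kappa>) \<in> cohomologous \<pi> l R S k"
      using cohomologousD[OF *] AL_coboundaries_scale[OF assms cohomologousD(3)[OF *], of "-1"]
      by (intro cohomologousI) simp_all
  qed
  show "trans (cohomologous \<pi> l R S k)"
    using cohomologous_trans[OF assms] by (intro transI) blast
qed

lemma packing_cohomologyE:
  assumes "A \<in> packing_cohomology \<pi> l R S k"
  obtains \<kappa> where "\<kappa> \<in> AL_cocycles \<pi> l R S k" "A = cohomologous \<pi> l R S k `` {\<kappa>}"
  using assms unfolding packing_cohomology_def by (auto elim: quotientE)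

lemma packing_cohomologyI:
  "\<kappa> \<in> AL_cocycles \<pi> l R S k \<Longrightarrow> cohomologous \<pi> l R S k `` {\<kappa>} \<in> packing_cohomology \<pi> l R S k"
  unfolding packing_cohomology_def by (rule quotientI)

text \<open>Evaluates an operation defined as a union over representatives: all classes in the union
  coincide because \<open>h\<close> respects the relations, and the union is nonempty because
  \<open>z\<close> represents its own class.\<close>

lemma Union_classes_eq:
  assumes "equiv Z E" "equiv Z' E'" "z \<in> Z" "\<And>x y. (x, y) \<in> E \<Longrightarrow> (h x, h y) \<in> E'"
  shows "(\<Union>x\<in>E `` {z}. E' `` {h x}) = E' `` {h z}"
proof -
  have "E' `` {h x} = E' `` {h z}" if "x \<in> E `` {z}" for x
    using that assms(4)[of z x] equiv_class_eq[OF assms(2)] by auto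
  then show ?thesis
    using equiv_class_self[OF assms(1,3)] by blast
qed

lemma Union_classes_eq2:
  assumes "equiv Z E" "equiv Y F" "equiv Z' E'" "z \<in> Z" "y \<in> Y"
    "\<And>x x' u u'. (x, x') \<in> E \<Longrightarrow> (u, u') \<in> F \<Longrightarrow> (h x u, h x' u') \<in> E'"
  shows "(\<Union>x\<in>E `` {z}. \<Union>u\<in>F `` {y}. E' `` {h x u}) = E' `` {h z y}"
proof -
  have "E' `` {h x u} = E' `` {h z y}" if "x \<in> E `` {z}" "u \<in> F `` {y}" for x u
    using that assms(6)[of z x y u] equiv_class_eq[OF assms(3)] by auto
  then show ?thesis
    using equiv_class_self[OF assms(1,4)] equiv_class_self[OF assms(2,5)] by blast
qed

lemma class_add_eq:
  assumes "exponents \<pi>" "\<kappa> \<in> AL_cocycles \<pi> l R S k" "\<mu> \<in> AL_cocycles \<pi> l R S k"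
  shows "class_add \<pi> l R S k (cohomologous \<pi> l R S k `` {\<kappa>}) (cohomologous \<pi> l R S k `` {\<mu>}) =
    cohomologous \<pi> l R S k `` {\<lambda>xs. \<kappa> xs + \<mu> xs}"
  unfolding class_add_def
  by (rule Union_classes_eq2[where h = "\<lambda>\<kappa> \<mu> xs. \<kappa> xs + \<mu> xs", OF equiv_cohomologous[OF assms(1)]
        equiv_cohomologous[OF assms(1)] equiv_cohomologous[OF assms(1)] assms(2,3)])
    (rule cohomologous_add[OF assms(1)])

lemma class_scale_eq:
  assumes "exponents \<pi>" "\<kappa> \<in> AL_cocycles \<pi> l R S k"
  shows "class_scale \<pi> l R S k a (cohomologous \<pi> l R S k `` {\<kappa>}) =
    cohomologous \<pi> l R S k `` {\<lambda>xs. a * \<kappa> xs}"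
  unfolding class_scale_def
  by (rule Union_classes_eq[where h = "\<lambda>\<kappa> xs. a * \<kappa> xs", OF equiv_cohomologous[OF assms(1)]
        equiv_cohomologous[OF assms(1)] assms(2)])
    (rule cohomologous_scale[OF assms(1)])

section \<open>The cup-product on cochains and on classes\<close>

lemma tuples_permute_take_drop:
  assumes "xs \<in> tuples (k + k') c r" "\<sigma> permutes {..<length xs}"
  shows "take (Suc k) (permute_list \<sigma> xs) \<in> tuples k c r"
    "drop k (permute_list \<sigma> xs) \<in> tuples k' c r"
proof -
  have "set (permute_list \<sigma> xs) = set xs" using assms(2) by simp
  then show "take (Suc k) (permute_list \<sigma> xs) \<in> tuples k c r"
    "drop k (permute_list \<sigma> xs) \<in> tuples k' c r"
    using assms(1) set_take_subset[of "Suc k" "permute_list \<sigma> xs"]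
      set_drop_subset[of k "permute_list \<sigma> xs"]
    by (auto simp: tuples_def)
qed

text \<open>The front and back faces of a reordered tuple lie in the same ball as the tuple, so a
  product of two values in that ball bounds the cup-product and the pointwise estimate for products
  applies.\<close>

lemma cup_in_AL_space:
  assumes "1 \<le> p" "1 \<le> p'" "1 \<le> q" "inverse p + inverse p' = inverse q"
    and "\<kappa> \<in> AL_space p l R S k" "\<mu> \<in> AL_space p' l R S k'"
  shows "cup_cochain S k k' \<kappa> \<mu> \<in> AL_space q l R S (k + k')"
proof -
  have "\<exists>us\<in>tuples k c r. \<exists>vs\<in>tuples k' c r. \<bar>cup_cochain S k k' \<kappa> \<mu> xs\<bar> \<le> \<bar>\<kappa> us\<bar> * \<bar>\<mu> vs\<bar>"
    if xs: "xs \<in> tuples (k + k') c r" for c r xs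
  proof -
    obtain \<sigma> where \<sigma>: "\<sigma> permutes {..<length xs}"
      and le: "\<bar>alt (raw_cup k \<kappa> \<mu>) xs\<bar> \<le> \<bar>raw_cup k \<kappa> \<mu> (permute_list \<sigma> xs)\<bar>"
      by (rule alt_bound)
    have "\<bar>cup_cochain S k k' \<kappa> \<mu> xs\<bar> \<le> \<bar>alt (raw_cup k \<kappa> \<mu>) xs\<bar>"
      by (simp add: cup_cochain_eq on_simplices_def)
    with le tuples_permute_take_drop[OF xs \<sigma>] show ?thesis
      by (intro bexI) (auto simp: raw_cup_def abs_mult)
  qed
  then have "packing_norm q l R S (k + k') (cup_cochain S k k' \<kappa> \<mu>) < \<infinity>"
    using assms by (intro packing_norm_product[OF assms(1-4), where \<kappa> = \<kappa> and \<mu> = \<mu>])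
      (auto simp: AL_space_def)
  moreover have "cup_cochain S k k' \<kappa> \<mu> \<in> AS_cochains S (k + k')"
    unfolding cup_cochain_eq by (intro on_simplices_in_AS_cochains skew_alt)
  ultimately show ?thesis by (simp add: AL_space_def)
qed

text \<open>This is the antisymmetrized Leibniz rule, since \<open>alt\<close> commutes with
  \<open>delta\<close>. Front and back faces of a reordered simplex are simplices, and there
  \<open>coboundary\<close> agrees with \<open>delta\<close>.\<close>

lemma coboundary_cup:
  "coboundary S (k + k') (cup_cochain S k k' \<kappa> \<mu>) = (\<lambda>xs.
     cup_cochain S (Suc k) k' (coboundary S k \<kappa>) \<mu> xs +
     (-1) ^ k * cup_cochain S k (Suc k') \<kappa> (coboundary S k' \<mu>) xs)"
proof
  fix xs :: "'a list"
  show "coboundary S (k + k') (cup_cochain S k k' \<kappa> \<mu>) xs =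
     cup_cochain S (Suc k) k' (coboundary S k \<kappa>) \<mu> xs +
     (-1) ^ k * cup_cochain S k (Suc k') \<kappa> (coboundary S k' \<mu>) xs"
  proof (cases "rips_simplex S (Suc (k + k')) xs")
    case True
    have "alt (delta (raw_cup k \<kappa> \<mu>)) xs = alt (\<lambda>ys. raw_cup (Suc k) (coboundary S k \<kappa>) \<mu> ys +
        (-1) ^ k * raw_cup k \<kappa> (coboundary S k' \<mu>) ys) xs"
    proof (rule alt_cong)
      fix \<sigma> assume \<sigma>: "\<sigma> permutes {..<length xs}"
      let ?ys = "permute_list \<sigma> xs"
      have ys: "rips_simplex S (Suc k + k') ?ys" "rips_simplex S (k + Suc k') ?ys"
        using True by (simp_all add: rips_simplex_permute[OF \<sigma>])
      have "Suc (Suc k) \<le> length ?ys" using rips_simplex_length[OF ys(1)] by simp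
      note delta_raw_cup[OF this, of \<kappa> \<mu>]
      moreover have "coboundary S k \<kappa> (take (Suc (Suc k)) ?ys) = delta \<kappa> (take (Suc (Suc k)) ?ys)"
        using rips_simplex_take[OF ys(1)] by (simp add: coboundary_eq on_simplices_def)
      moreover have "coboundary S k' \<mu> (drop k ?ys) = delta \<mu> (drop k ?ys)"
        using rips_simplex_drop[OF ys(2)] by (simp add: coboundary_eq on_simplices_def)
      ultimately show "delta (raw_cup k \<kappa> \<mu>) ?ys = raw_cup (Suc k) (coboundary S k \<kappa>) \<mu> ?ys +
          (-1) ^ k * raw_cup k \<kappa> (coboundary S k' \<mu>) ?ys"
        by (simp add: raw_cup_def)
    qed
    then show ?thesis
      using True unfolding cup_cochain_eq coboundary_on_simplices
      by (simp add: on_simplices_def delta_alt alt_add alt_cmult)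
  next
    case False
    then show ?thesis by (simp add: coboundary_def cup_cochain_def)
  qed
qed

lemma cup_diff_left:
  "cup_cochain S k k' (\<lambda>xs. \<kappa> xs - \<kappa>' xs) \<mu> xs =
     cup_cochain S k k' \<kappa> \<mu> xs - cup_cochain S k k' \<kappa>' \<mu> xs"
  by (simp add: cup_cochain_def algebra_simps sum_subtractf diff_divide_distrib)

lemma cup_diff_right:
  "cup_cochain S k k' \<kappa> (\<lambda>xs. \<mu> xs - \<mu>' xs) xs =
     cup_cochain S k k' \<kappa> \<mu> xs - cup_cochain S k k' \<kappa> \<mu>' xs"
  by (simp add: cup_cochain_def algebra_simps sum_subtractf diff_divide_distrib)

lemma cup_zero:
  "cup_cochain S k k' (\<lambda>_. 0) \<mu> = (\<lambda>_. 0)" "cup_cochain S k k' \<kappa> (\<lambda>_. 0) = (\<lambda>_. 0)"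
  by (simp_all add: cup_cochain_def fun_eq_iff)

lemma cup_in_AL_cocycles:
  assumes "exponents \<pi>" "exponents \<pi>'" "exponents \<pi>''" "cup_exponents \<pi> k \<pi>' k' \<pi>''"
    and "\<kappa> \<in> AL_cocycles \<pi> l R S k" "\<mu> \<in> AL_cocycles \<pi>' l R S k'"
  shows "cup_cochain S k k' \<kappa> \<mu> \<in> AL_cocycles \<pi>'' l R S (k + k')"
  using assms
  by (auto simp: AL_cocycles_iff coboundary_cup cup_zero exponents_def cup_exponents_def
      intro!: cup_in_AL_space[of "\<pi> k" "\<pi>' k'"])

text \<open>As \<open>\<kappa>\<close> is a cocycle, the Leibniz rule leaves one term, so the
  cup-product of \<open>\<kappa>\<close> with a primitive of \<open>\<mu>\<close> is a primitive up
  to the sign (-1)^k. The exponent relation with index \<open>k' - 1\<close> places it in the right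
  space.\<close>

lemma cup_coboundary_right:
  assumes e: "exponents \<pi>" "exponents \<pi>'" "exponents \<pi>''" "cup_exponents \<pi> k \<pi>' k' \<pi>''"
    and \<kappa>: "\<kappa> \<in> AL_cocycles \<pi> l R S k" and \<mu>: "\<mu> \<in> AL_coboundaries \<pi>' l R S k'"
  shows "cup_cochain S k k' \<kappa> \<mu> \<in> AL_coboundaries \<pi>'' l R S (k + k')"
proof (cases k')
  case 0
  then show ?thesis using \<mu> AL_coboundaries_zero by (simp add: cup_zero)
next
  case (Suc j)
  then obtain \<beta> where \<beta>: "\<beta> \<in> AL_complex \<pi>' l R S j" "\<mu> = coboundary S j \<beta>"
    using \<mu> by auto
  have rel: "inverse (\<pi> k) + inverse (\<pi>' (Suc j)) = inverse (\<pi>'' (Suc (k + j)))"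
    "inverse (\<pi> k) + inverse (\<pi>' j) = inverse (\<pi>'' (k + j))"
    using e(4) by (simp_all add: cup_exponents_def Suc)
  have ge: "1 \<le> \<pi> i" "1 \<le> \<pi>' i" "1 \<le> \<pi>'' i" for i
    using e by (simp_all add: exponents_def)
  let ?\<gamma> = "\<lambda>xs. (-1) ^ k * cup_cochain S k j \<kappa> \<beta> xs"
  have in1: "cup_cochain S k j \<kappa> \<beta> \<in> AL_space (\<pi>'' (k + j)) l R S (k + j)"
    using \<kappa> \<beta>(1) by (intro cup_in_AL_space[OF ge(1) ge(2) ge(3) rel(2)])
      (auto simp: AL_cocycles_iff AL_complex_def)
  have in2: "cup_cochain S k (Suc j) \<kappa> (coboundary S j \<beta>) \<in>
      AL_space (\<pi>'' (Suc (k + j))) l R S (k + Suc j)"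
    using \<kappa> \<beta>(1) by (intro cup_in_AL_space[OF ge(1) ge(2) ge(3) rel(1)])
      (auto simp: AL_cocycles_iff AL_complex_def)
  have d: "coboundary S (k + j) ?\<gamma> = cup_cochain S k k' \<kappa> \<mu>"
    using \<kappa> by (simp add: coboundary_scale coboundary_cup AL_cocycles_iff cup_zero \<beta>(2) Suc
        flip: mult.assoc power_mult_distrib)
  have "?\<gamma> \<in> AL_complex \<pi>'' l R S (k + j)"
    unfolding AL_complex_def using in2
    by (simp add: AL_space_scale[OF ge(3) in1] d) (simp add: Suc \<beta>(2))
  then have "coboundary S (k + j) ?\<gamma> \<in> coboundary S (k + j) ` AL_complex \<pi>'' l R S (k + j)"
    by (rule imageI)
  then show ?thesis
    unfolding d by (simp add: Suc)
qed

text \<open>Here the surviving term of the Leibniz rule is the one without a sign; the exponent of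
  the primitive comes from the relation with index \<open>k - 1\<close>.\<close>

lemma cup_coboundary_left:
  assumes e: "exponents \<pi>" "exponents \<pi>'" "exponents \<pi>''" "cup_exponents \<pi> k \<pi>' k' \<pi>''"
    and \<kappa>: "\<kappa> \<in> AL_coboundaries \<pi> l R S k" and \<mu>: "\<mu> \<in> AL_cocycles \<pi>' l R S k'"
  shows "cup_cochain S k k' \<kappa> \<mu> \<in> AL_coboundaries \<pi>'' l R S (k + k')"
proof (cases k)
  case 0
  then show ?thesis using \<kappa> AL_coboundaries_zero by (simp add: cup_zero)
next
  case (Suc j)
  then obtain \<alpha> where \<alpha>: "\<alpha> \<in> AL_complex \<pi> l R S j" "\<kappa> = coboundary S j \<alpha>"
    using \<kappa> by auto
  have rel: "inverse (\<pi> (Suc j)) + inverse (\<pi>' k') = inverse (\<pi>'' (Suc (j + k')))"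
    "inverse (\<pi> j) + inverse (\<pi>' k') = inverse (\<pi>'' (j + k'))"
    using e(4) by (simp_all add: cup_exponents_def Suc add.commute)
  have ge: "1 \<le> \<pi> i" "1 \<le> \<pi>' i" "1 \<le> \<pi>'' i" for i
    using e by (simp_all add: exponents_def)
  have in1: "cup_cochain S j k' \<alpha> \<mu> \<in> AL_space (\<pi>'' (j + k')) l R S (j + k')"
    using \<mu> \<alpha>(1) by (intro cup_in_AL_space[OF ge(1) ge(2) ge(3) rel(2)])
      (auto simp: AL_cocycles_iff AL_complex_def)
  have in2: "cup_cochain S (Suc j) k' (coboundary S j \<alpha>) \<mu> \<in>
      AL_space (\<pi>'' (Suc (j + k'))) l R S (Suc j + k')"
    using \<mu> \<alpha>(1) by (intro cup_in_AL_space[OF ge(1) ge(2) ge(3) rel(1)])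
      (auto simp: AL_cocycles_iff AL_complex_def)
  have d: "coboundary S (j + k') (cup_cochain S j k' \<alpha> \<mu>) = cup_cochain S k k' \<kappa> \<mu>"
    using \<mu> by (simp add: coboundary_cup AL_cocycles_iff cup_zero \<alpha>(2) Suc)
  have "cup_cochain S j k' \<alpha> \<mu> \<in> AL_complex \<pi>'' l R S (j + k')"
    unfolding AL_complex_def using in1 in2 by (simp add: d) (simp add: Suc \<alpha>(2))
  then have "coboundary S (j + k') (cup_cochain S j k' \<alpha> \<mu>) \<in>
      coboundary S (j + k') ` AL_complex \<pi>'' l R S (j + k')"
    by (rule imageI)
  then show ?thesis
    unfolding d by (simp add: Suc)
qed

text \<open>The factors are changed one at a time, so that each difference is the product of a
  cocycle and a coboundary.\<close>

lemma cohomologous_cup: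
  assumes e: "exponents \<pi>" "exponents \<pi>'" "exponents \<pi>''" "cup_exponents \<pi> k \<pi>' k' \<pi>''"
    and \<kappa>: "(\<kappa>, \<kappa>') \<in> cohomologous \<pi> l R S k" and \<mu>: "(\<mu>, \<mu>') \<in> cohomologous \<pi>' l R S k'"
  shows "(cup_cochain S k k' \<kappa> \<mu>, cup_cochain S k k' \<kappa>' \<mu>') \<in> cohomologous \<pi>'' l R S (k + k')"
proof (rule cohomologous_trans[OF e(3)])
  note \<kappa> = cohomologousD[OF \<kappa>] and \<mu> = cohomologousD[OF \<mu>]
  show "(cup_cochain S k k' \<kappa> \<mu>, cup_cochain S k k' \<kappa> \<mu>') \<in> cohomologous \<pi>'' l R S (k + k')"
    by (rule cohomologousI[OF cup_in_AL_cocycles[OF e \<kappa>(1) \<mu>(1)] cup_in_AL_cocycles[OF e \<kappa>(1) \<mu>(2)]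
          cup_coboundary_right[OF e \<kappa>(1) \<mu>(3)]]) (simp add: cup_diff_right)
  show "(cup_cochain S k k' \<kappa> \<mu>', cup_cochain S k k' \<kappa>' \<mu>') \<in> cohomologous \<pi>'' l R S (k + k')"
    by (rule cohomologousI[OF cup_in_AL_cocycles[OF e \<kappa>(1) \<mu>(2)] cup_in_AL_cocycles[OF e \<kappa>(2) \<mu>(2)]
          cup_coboundary_left[OF e \<kappa>(3) \<mu>(2)]]) (simp add: cup_diff_left)
qed

lemma class_cup_eq:
  assumes "exponents \<pi>" "exponents \<pi>'" "exponents \<pi>''" "cup_exponents \<pi> k \<pi>' k' \<pi>''"
    and "\<kappa> \<in> AL_cocycles \<pi> l R S k" "\<mu> \<in> AL_cocycles \<pi>' l R S k'"
  shows "class_cup \<pi>'' l R S k k' (cohomologous \<pi> l R S k `` {\<kappa>}) (cohomologous \<pi>' l R S k' `` {\<mu>}) =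
    cohomologous \<pi>'' l R S (k + k') `` {cup_cochain S k k' \<kappa> \<mu>}"
  unfolding class_cup_def
  by (rule Union_classes_eq2[where h = "cup_cochain S k k'", OF equiv_cohomologous[OF assms(1)]
        equiv_cohomologous[OF assms(2)] equiv_cohomologous[OF assms(3)] assms(5,6)])
    (rule cohomologous_cup[OF assms(1-4)])

section \<open>Functoriality and homotopy invariance\<close>

text \<open>Isolates the properties of a coarse embedding that act on cochains. The centre
  \<open>\<phi> x\<close> comes from a choice of balls containing the images of
  \<open>S\<close>-balls and need not be \<open>f x\<close>; one \<open>\<phi>\<close> can therefore
  serve two maps.\<close>

locale controlled_map =
  fixes f :: "'a::metric_space \<Rightarrow> 'b::metric_space" and \<phi> :: "'a \<Rightarrow> 'b" and l' R' S' l R S :: real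
  assumes packing_map: "packing_map \<phi> l' R' S' l R S"
    and image_ball: "f ` ball x S \<subseteq> ball (\<phi> x) R'"
    and R'_le_S': "R' \<le> S'"
begin

lemma image_ball_S': "f ` ball x S \<subseteq> ball (\<phi> x) S'"
  using image_ball R'_le_S' by (meson order_trans subset_ball)

lemma rips_simplex_map:
  assumes "rips_simplex S k xs" "distinct (map f xs)"
  shows "rips_simplex S' k (map f xs)"
proof -
  obtain c where "set xs \<subseteq> ball c S" using assms(1) by (auto simp: rips_simplex_def)
  then have "set (map f xs) \<subseteq> ball (\<phi> c) S'" using image_ball_S' by fastforce
  then show ?thesis using assms by (auto simp: rips_simplex_def)
qed

lemma map_tuples:
  assumes "r \<le> S" "xs \<in> tuples k c r"
  shows "map f xs \<in> tuples k (\<phi> c) R'"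
proof -
  have "f ` set xs \<subseteq> f ` ball c S"
    using assms subset_ball[of r S c] by (auto simp: tuples_def)
  then show ?thesis using assms(2) image_ball[of c] by (auto simp: tuples_def)
qed

text \<open>If \<open>f\<close> identifies vertices of a simplex, the right-hand side is 0 by
  convention because the image is no simplex, while the alternating sum on the left vanishes by
  skew-symmetry of \<open>delta \<kappa>\<close>.\<close>

lemma coboundary_pull:
  assumes "\<kappa> \<in> AS_cochains S' k"
  shows "coboundary S k (pull_cochain f S k \<kappa>) = pull_cochain f S (Suc k) (coboundary S' k \<kappa>)"
proof
  fix xs
  have "delta \<kappa> (map f xs) = coboundary S' k \<kappa> (map f xs)" if "rips_simplex S (Suc k) xs"
  proof (cases "distinct (map f xs)")
    case True
    then show ?thesis
      using rips_simplex_map[OF that] by (simp add: coboundary_eq on_simplices_def)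
  next
    case False
    have "skew (length (map f xs)) (delta \<kappa>)"
      using assms rips_simplex_length[OF that] by (simp add: AS_cochains_iff skew_delta)
    then have "delta \<kappa> (map f xs) = 0" using False by (rule skew_eq_0)
    then show ?thesis by (simp add: coboundary_eq on_simplices_def)
  qed
  then show "coboundary S k (pull_cochain f S k \<kappa>) xs =
      pull_cochain f S (Suc k) (coboundary S' k \<kappa>) xs"
    unfolding pull_cochain_eq coboundary_on_simplices
    by (simp add: on_simplices_def delta_map)
qed

lemma packing_norm_pull:
  "packing_norm p l R S k (pull_cochain f S k \<kappa>) \<le> packing_norm p l' R' S' k \<kappa>"
proof (rule packing_norm_transfer[OF packing_map])
  fix c :: 'a and r and xs assume "r \<le> S" "xs \<in> tuples k c r"
  then have "map f xs \<in> tuples k (\<phi> c) R'" by (rule map_tuples)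
  then show "\<exists>zs\<in>tuples k (\<phi> c) R'. \<bar>pull_cochain f S k \<kappa> xs\<bar> \<le> \<bar>\<kappa> zs\<bar>"
    by (intro bexI[of _ "map f xs"]) (simp add: pull_cochain_def)
qed

lemma pull_in_AL_space:
  assumes "\<kappa> \<in> AL_space p l' R' S' k"
  shows "pull_cochain f S k \<kappa> \<in> AL_space p l R S k"
proof -
  have "skew (Suc k) (\<lambda>xs. \<kappa> (map f xs))"
    using assms by (simp add: AL_space_def AS_cochains_iff skew_def flip: permute_list_map)
  then show ?thesis
    using assms le_less_trans[OF packing_norm_pull]
    by (auto simp: AL_space_def pull_cochain_eq intro: on_simplices_in_AS_cochains)
qed

lemma pull_in_AL_complex:
  assumes "\<kappa> \<in> AL_complex \<pi> l' R' S' k"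
  shows "pull_cochain f S k \<kappa> \<in> AL_complex \<pi> l R S k"
    "coboundary S k (pull_cochain f S k \<kappa>) = pull_cochain f S (Suc k) (coboundary S' k \<kappa>)"
proof -
  show eq: "coboundary S k (pull_cochain f S k \<kappa>) = pull_cochain f S (Suc k) (coboundary S' k \<kappa>)"
    using assms by (simp add: coboundary_pull AL_complex_def AL_space_def)
  show "pull_cochain f S k \<kappa> \<in> AL_complex \<pi> l R S k"
    using assms by (simp add: eq AL_complex_def pull_in_AL_space)
qed

lemma pull_in_AL_cocycles:
  assumes "\<kappa> \<in> AL_cocycles \<pi> l' R' S' k"
  shows "pull_cochain f S k \<kappa> \<in> AL_cocycles \<pi> l R S k"
  using assms pull_in_AL_complex[of \<kappa> \<pi> k] by (simp add: AL_cocycles_def) (simp add: pull_cochain_def)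

lemma pull_in_AL_coboundaries:
  assumes "\<kappa> \<in> AL_coboundaries \<pi> l' R' S' k"
  shows "pull_cochain f S k \<kappa> \<in> AL_coboundaries \<pi> l R S k"
proof (cases k)
  case 0
  then show ?thesis using assms by (simp add: pull_cochain_def)
next
  case (Suc j)
  then obtain \<alpha> where "\<alpha> \<in> AL_complex \<pi> l' R' S' j" "\<kappa> = coboundary S' j \<alpha>"
    using assms by auto
  then show ?thesis
    using Suc pull_in_AL_complex[of \<alpha> \<pi> j] by (auto simp flip: pull_in_AL_complex(2))
qed

lemma pull_cohomologous:
  assumes "(\<kappa>, \<mu>) \<in> cohomologous \<pi> l' R' S' k"
  shows "(pull_cochain f S k \<kappa>, pull_cochain f S k \<mu>) \<in> cohomologous \<pi> l R S k"
  using cohomologousD[OF assms]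
  by (intro cohomologousI[OF _ _ pull_in_AL_coboundaries[OF cohomologousD(3)[OF assms]]]
      pull_in_AL_cocycles) (simp_all add: pull_cochain_def)

lemma pull_class_eq:
  assumes "exponents \<pi>" "\<kappa> \<in> AL_cocycles \<pi> l' R' S' k"
  shows "pull_class f \<pi> l R S k (cohomologous \<pi> l' R' S' k `` {\<kappa>}) =
    cohomologous \<pi> l R S k `` {pull_cochain f S k \<kappa>}"
  unfolding pull_class_def
  by (rule Union_classes_eq[OF equiv_cohomologous[OF assms(1)] equiv_cohomologous[OF assms(1)] assms(2)])
    (rule pull_cohomologous)

text \<open>Antisymmetrization commutes with mapping over lists. If the image has repeated vertices,
  the cochain on the left is 0 there by convention, and the antisymmetrized product is 0 by
  skew-symmetry.\<close>

lemma pull_cup: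
  "pull_cochain f S (k + k') (cup_cochain S' k k' \<kappa> \<mu>) =
     cup_cochain S k k' (pull_cochain f S k \<kappa>) (pull_cochain f S k' \<mu>)"
proof
  fix xs
  show "pull_cochain f S (k + k') (cup_cochain S' k k' \<kappa> \<mu>) xs =
     cup_cochain S k k' (pull_cochain f S k \<kappa>) (pull_cochain f S k' \<mu>) xs"
  proof (cases "rips_simplex S (k + k') xs")
    case True
    have "alt (raw_cup k (pull_cochain f S k \<kappa>) (pull_cochain f S k' \<mu>)) xs =
        alt (\<lambda>ys. raw_cup k \<kappa> \<mu> (map f ys)) xs"
    proof (rule alt_cong)
      fix \<sigma> assume "\<sigma> permutes {..<length xs}"
      then have "rips_simplex S (k + k') (permute_list \<sigma> xs)"
        using True by (simp add: rips_simplex_permute)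
      then show "raw_cup k (pull_cochain f S k \<kappa>) (pull_cochain f S k' \<mu>) (permute_list \<sigma> xs) =
          raw_cup k \<kappa> \<mu> (map f (permute_list \<sigma> xs))"
        using rips_simplex_take[of S k k' "permute_list \<sigma> xs"]
          rips_simplex_drop[of S k k' "permute_list \<sigma> xs"]
        by (simp add: raw_cup_def pull_cochain_def take_map drop_map)
    qed
    also have "\<dots> = alt (raw_cup k \<kappa> \<mu>) (map f xs)" by (rule alt_map)
    also have "\<dots> = cup_cochain S' k k' \<kappa> \<mu> (map f xs)"
    proof (cases "distinct (map f xs)")
      case distinct: True
      then show ?thesis
        using rips_simplex_map[OF True] by (simp add: cup_cochain_eq on_simplices_def)
    next
      case False
      have "alt (raw_cup k \<kappa> \<mu>) (map f xs) = 0"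
        using skew_alt False by (rule skew_eq_0)
      moreover have "\<not> rips_simplex S' (k + k') (map f xs)"
        using False by (simp add: rips_simplex_def)
      ultimately show ?thesis by (simp add: cup_cochain_eq on_simplices_def)
    qed
    finally show ?thesis using True by (simp add: cup_cochain_eq on_simplices_def pull_cochain_def)
  next
    case False
    then show ?thesis by (simp add: pull_cochain_def cup_cochain_def)
  qed
qed

lemma pull_class_in_packing_cohomology:
  assumes "exponents \<pi>" "A \<in> packing_cohomology \<pi> l' R' S' k"
  shows "pull_class f \<pi> l R S k A \<in> packing_cohomology \<pi> l R S k"
proof -
  obtain \<kappa> where "\<kappa> \<in> AL_cocycles \<pi> l' R' S' k" "A = cohomologous \<pi> l' R' S' k `` {\<kappa>}"
    using assms(2) by (rule packing_cohomologyE)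
  then show ?thesis
    by (simp add: pull_class_eq[OF assms(1)] packing_cohomologyI pull_in_AL_cocycles)
qed

lemma pull_class_add:
  assumes e: "exponents \<pi>"
    and "A \<in> packing_cohomology \<pi> l' R' S' k" "B \<in> packing_cohomology \<pi> l' R' S' k"
  shows "pull_class f \<pi> l R S k (class_add \<pi> l' R' S' k A B) =
    class_add \<pi> l R S k (pull_class f \<pi> l R S k A) (pull_class f \<pi> l R S k B)"
proof -
  obtain \<kappa> \<mu> where \<kappa>: "\<kappa> \<in> AL_cocycles \<pi> l' R' S' k" "\<mu> \<in> AL_cocycles \<pi> l' R' S' k"
    and AB: "A = cohomologous \<pi> l' R' S' k `` {\<kappa>}" "B = cohomologous \<pi> l' R' S' k `` {\<mu>}"
    using assms(2,3) by (elim packing_cohomologyE) blast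
  have "pull_cochain f S k (\<lambda>xs. \<kappa> xs + \<mu> xs) =
      (\<lambda>xs. pull_cochain f S k \<kappa> xs + pull_cochain f S k \<mu> xs)"
    by (simp add: pull_cochain_def fun_eq_iff)
  then show ?thesis
    using e \<kappa> by (simp add: AB class_add_eq pull_class_eq AL_cocycles_add pull_in_AL_cocycles)
qed

lemma pull_class_scale:
  assumes e: "exponents \<pi>" and "A \<in> packing_cohomology \<pi> l' R' S' k"
  shows "pull_class f \<pi> l R S k (class_scale \<pi> l' R' S' k a A) =
    class_scale \<pi> l R S k a (pull_class f \<pi> l R S k A)"
proof -
  obtain \<kappa> where \<kappa>: "\<kappa> \<in> AL_cocycles \<pi> l' R' S' k" and A: "A = cohomologous \<pi> l' R' S' k `` {\<kappa>}"
    using assms(2) by (elim packing_cohomologyE) blast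
  have "pull_cochain f S k (\<lambda>xs. a * \<kappa> xs) = (\<lambda>xs. a * pull_cochain f S k \<kappa> xs)"
    by (simp add: pull_cochain_def fun_eq_iff)
  then show ?thesis
    using e \<kappa> by (simp add: A class_scale_eq pull_class_eq AL_cocycles_scale pull_in_AL_cocycles)
qed

lemma induces_morphism:
  assumes "exponents \<pi>"
  shows "induces_morphism f \<pi> l' R' S' l R S"
proof -
  have "\<exists>c. f ` V \<subseteq> ball c S'" if "V \<subseteq> ball c S" for V c
    using image_mono[OF that, of f] image_ball_S' by blast
  moreover have "\<exists>C::real. \<forall>\<kappa>\<in>AL_space (\<pi> k) l' R' S' k.
      packing_norm (\<pi> k) l R S k (pull_cochain f S k \<kappa>) \<le> ennreal C * packing_norm (\<pi> k) l' R' S' k \<kappa>"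
    for k
    by (intro exI[of _ 1]) (simp add: packing_norm_pull)
  ultimately show ?thesis
    unfolding induces_morphism_def
    by (intro conjI allI impI ballI pull_in_AL_complex pull_class_in_packing_cohomology[OF assms]
        pull_class_add[OF assms] pull_class_scale[OF assms]) auto
qed

lemma is_multiplicative:
  assumes e: "exponents \<pi>"
  shows "is_multiplicative f \<pi> l' R' S' l R S"
  unfolding is_multiplicative_def
proof (intro allI impI ballI conjI)
  fix \<pi>' \<pi>'' k k' and A B :: "'b cochain set"
  assume e': "exponents \<pi>'" and e'': "exponents \<pi>''" and cup: "cup_exponents \<pi> k \<pi>' k' \<pi>''"
    and A: "A \<in> packing_cohomology \<pi> l' R' S' k" and B: "B \<in> packing_cohomology \<pi>' l' R' S' k'"
  show "pull_class f \<pi>' l R S k' B \<in> packing_cohomology \<pi>' l R S k'"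
    using e' B by (rule pull_class_in_packing_cohomology)
  obtain \<kappa> where \<kappa>: "\<kappa> \<in> AL_cocycles \<pi> l' R' S' k" "A = cohomologous \<pi> l' R' S' k `` {\<kappa>}"
    using A by (rule packing_cohomologyE)
  obtain \<mu> where \<mu>: "\<mu> \<in> AL_cocycles \<pi>' l' R' S' k'" "B = cohomologous \<pi>' l' R' S' k' `` {\<mu>}"
    using B by (rule packing_cohomologyE)
  note cocycle = cup_in_AL_cocycles[OF e e' e'' cup]
  show "class_cup \<pi>'' l' R' S' k k' A B \<in> packing_cohomology \<pi>'' l' R' S' (k + k')"
    using e e' e'' cup \<kappa> \<mu> cocycle[OF \<kappa>(1) \<mu>(1)] by (simp add: class_cup_eq packing_cohomologyI)
  show "pull_class f \<pi>'' l R S (k + k') (class_cup \<pi>'' l' R' S' k k' A B) =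
      class_cup \<pi>'' l R S k k' (pull_class f \<pi> l R S k A) (pull_class f \<pi>' l R S k' B)"
    using e e' e'' cup \<kappa> \<mu> cocycle[OF \<kappa>(1) \<mu>(1)]
    by (simp add: class_cup_eq pull_class_eq pull_in_AL_cocycles pull_cup)
qed

end

section \<open>Homotopy between two maps with common centres\<close>

locale controlled_pair = f: controlled_map f \<phi> l' R' S' l R S + g: controlled_map g \<phi> l' R' S' l R S
  for f g \<phi> l' R' S' l R S
begin

text \<open>The prism operator does not preserve skew-symmetry, hence the antisymmetrization.\<close>

definition homotopy :: "nat \<Rightarrow> 'b cochain \<Rightarrow> 'a cochain" where
  "homotopy k \<kappa> = on_simplices S k (alt (prism f g \<kappa>))"

text \<open>All tuples mixing \<open>f\<close>- and \<open>g\<close>-images of a tuple lie in the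
  ball about the common centre \<open>\<phi> c\<close>, so norms transfer as for a single map. The
  degree drops by one while the exponent stays \<open>p\<close>.\<close>

lemma homotopy_in_AL_space:
  assumes p: "1 \<le> p" and \<kappa>: "\<kappa> \<in> AL_space p l' R' S' (Suc k)"
  shows "homotopy k \<kappa> \<in> AL_space p l R S k"
proof -
  \<comment> \<open>The prism has \<open>Suc k\<close> terms. Scaling by \<open>1 / n\<close> yields
    the constant-free estimate that \<open>packing_norm_transfer\<close> requires; it is undone at
    the end.\<close>
  define n where "n = real (Suc k)"
  have n: "0 < n" by (simp add: n_def)
  have "\<exists>zs\<in>tuples (Suc k) (\<phi> c) R'. \<bar>1 / n * homotopy k \<kappa> xs\<bar> \<le> \<bar>\<kappa> zs\<bar>"
    if "r \<le> S" and xs: "xs \<in> tuples k c r" for c r xs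
  proof -
    obtain \<sigma> where \<sigma>: "\<sigma> permutes {..<length xs}"
      and 1: "\<bar>alt (prism f g \<kappa>) xs\<bar> \<le> \<bar>prism f g \<kappa> (permute_list \<sigma> xs)\<bar>"
      by (rule alt_bound)
    have len: "length xs = Suc k" using xs by (simp add: tuples_def)
    then have "permute_list \<sigma> xs \<noteq> []"
      by (metis length_permute_list list.size(3) nat.distinct(1))
    then obtain zs where zs: "length zs = Suc (length xs)" "set zs \<subseteq> f ` set xs \<union> g ` set xs"
      and 2: "\<bar>prism f g \<kappa> (permute_list \<sigma> xs)\<bar> \<le> n * \<bar>\<kappa> zs\<bar>"
      using \<sigma> len by (elim prism_bound[where f = f and g = g and \<phi> = \<kappa>]) (auto simp: n_def)
    have "set (map f xs) \<subseteq> ball (\<phi> c) R'" "set (map g xs) \<subseteq> ball (\<phi> c) R'"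
      using f.map_tuples[OF that] g.map_tuples[OF that] by (simp_all add: tuples_def)
    then have "zs \<in> tuples (Suc k) (\<phi> c) R'"
      using zs len subset_trans[of "set zs" "f ` set xs \<union> g ` set xs" "ball (\<phi> c) R'"]
      by (simp add: tuples_def)
    moreover have "\<bar>homotopy k \<kappa> xs\<bar> \<le> \<bar>alt (prism f g \<kappa>) xs\<bar>"
      by (simp add: homotopy_def on_simplices_def)
    then have "\<bar>homotopy k \<kappa> xs\<bar> \<le> n * \<bar>\<kappa> zs\<bar>" using 1 2 by linarith
    then have "\<bar>1 / n * homotopy k \<kappa> xs\<bar> \<le> \<bar>\<kappa> zs\<bar>"
      using n by (simp add: abs_mult divide_le_eq mult.commute)
    ultimately show ?thesis by blast
  qed
  then have "packing_norm p l R S k (\<lambda>xs. 1 / n * homotopy k \<kappa> xs) \<le> packing_norm p l' R' S' (Suc k) \<kappa>"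
    by (intro packing_norm_transfer[OF f.packing_map])
  then have "packing_norm p l R S k (\<lambda>xs. 1 / n * homotopy k \<kappa> xs) < \<infinity>"
    using \<kappa> by (auto simp: AL_space_def)
  from packing_norm_scale[OF p this, of n] have "packing_norm p l R S k (homotopy k \<kappa>) < \<infinity>"
    using n by simp
  then show ?thesis
    by (simp add: AL_space_def homotopy_def on_simplices_in_AS_cochains skew_alt)
qed

text \<open>The cocycle condition speaks of simplices; skew-symmetry of
  \<open>delta \<kappa>\<close> extends it to degenerate tuples, such as prism tuples in which an
  \<open>f\<close>-image and a \<open>g\<close>-image coincide.\<close>

lemma delta_eq_0:
  assumes "\<kappa> \<in> AL_cocycles \<pi> l' R' S' k" "length ys = Suc (Suc k)" "set ys \<subseteq> ball c S'"
  shows "delta \<kappa> ys = 0"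
proof (cases "distinct ys")
  case True
  then have "rips_simplex S' (Suc k) ys"
    using assms by (auto simp: rips_simplex_def)
  moreover have "coboundary S' k \<kappa> ys = 0"
    using assms(1) by (simp add: AL_cocycles_def)
  ultimately show ?thesis by (simp add: coboundary_eq on_simplices_def)
next
  case False
  have "skew (length ys) (delta \<kappa>)"
    using assms by (simp add: AL_cocycles_iff AL_space_def AS_cochains_iff skew_delta)
  then show ?thesis using False by (rule skew_eq_0)
qed

text \<open>In the antisymmetrized prism identity, the term with \<open>delta \<kappa>\<close>
  vanishes because its tuples lie in the ball of radius \<open>S'\<close> about
  \<open>\<phi> c\<close>. The cochain \<open>\<kappa>\<close> is already skew-symmetric, so
  \<open>alt\<close> leaves the two ends unchanged.\<close>

lemma coboundary_homotopy:
  assumes \<kappa>: "\<kappa> \<in> AL_cocycles \<pi> l' R' S' (Suc k)"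
  shows "coboundary S k (homotopy k \<kappa>) =
    (\<lambda>xs. pull_cochain g S (Suc k) \<kappa> xs - pull_cochain f S (Suc k) \<kappa> xs)"
proof
  fix xs
  show "coboundary S k (homotopy k \<kappa>) xs =
      pull_cochain g S (Suc k) \<kappa> xs - pull_cochain f S (Suc k) \<kappa> xs"
  proof (cases "rips_simplex S (Suc k) xs")
    case True
    then obtain c where c: "set xs \<subseteq> ball c S" by (auto simp: rips_simplex_def)
    have len: "length xs = Suc (Suc k)" using True by (rule rips_simplex_length)
    have skew: "skew (length (map h xs)) \<kappa>" for h
      using \<kappa> len by (simp add: AL_cocycles_iff AL_space_def AS_cochains_iff)
    have "alt (delta (prism f g \<kappa>)) xs = alt (\<lambda>ys. \<kappa> (map g ys) + (-1) * \<kappa> (map f ys)) xs"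
    proof (rule alt_cong)
      fix \<sigma> assume \<sigma>: "\<sigma> permutes {..<length xs}"
      let ?ys = "permute_list \<sigma> xs"
      have "prism f g (delta \<kappa>) ?ys = 0"
      proof (rule prism_eq_0)
        fix zs assume zs: "length zs = Suc (length ?ys)" "set zs \<subseteq> f ` set ?ys \<union> g ` set ?ys"
        have "f ` set xs \<union> g ` set xs \<subseteq> ball (\<phi> c) S'"
          using f.image_ball_S'[of c] g.image_ball_S'[of c] c by blast
        then have "set zs \<subseteq> ball (\<phi> c) S'"
          using zs(2) \<sigma> by (simp add: subset_trans)
        then show "delta \<kappa> zs = 0"
          using delta_eq_0[OF \<kappa>] zs(1) len by simp
      qed
      then show "delta (prism f g \<kappa>) ?ys = \<kappa> (map g ?ys) + (-1) * \<kappa> (map f ?ys)"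
        using prism_homotopy[of f g \<kappa> ?ys] by simp
    qed
    also have "\<dots> = \<kappa> (map g xs) - \<kappa> (map f xs)"
      by (simp only: alt_add alt_cmult alt_map alt_skew[OF skew])
    finally show ?thesis
      using True unfolding homotopy_def coboundary_on_simplices
      by (simp add: on_simplices_def delta_alt pull_cochain_def)
  next
    case False
    then show ?thesis by (simp add: coboundary_def pull_cochain_def)
  qed
qed

lemma pull_cohomologous_pull:
  assumes e: "exponents \<pi>" and ni: "nonincreasing_at \<pi> k" and \<kappa>: "\<kappa> \<in> AL_cocycles \<pi> l' R' S' k"
  shows "(pull_cochain g S k \<kappa>, pull_cochain f S k \<kappa>) \<in> cohomologous \<pi> l R S k"
proof -
  let ?d = "\<lambda>xs. pull_cochain g S k \<kappa> xs - pull_cochain f S k \<kappa> xs"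
  have "?d \<in> AL_coboundaries \<pi> l R S k"
  proof (cases k)
    case 0
    \<comment> \<open>In degree 0 the only coboundary is 0, so the pullbacks themselves must agree:
      \<open>f x\<close> and \<open>g x\<close> lie in one ball of radius \<open>S'\<close>, on
      which a 0-cocycle is constant.\<close>
    have "\<kappa> (map g xs) = \<kappa> (map f xs)" if xs: "rips_simplex S 0 xs" for xs
    proof -
      obtain x c where x: "xs = [x]" "x \<in> ball c S"
        using xs by (auto simp: rips_simplex_def length_Suc_conv)
      have "set [f x, g x] \<subseteq> ball (\<phi> c) S'"
        using x(2) f.image_ball_S'[of c] g.image_ball_S'[of c] by (simp add: image_subset_iff)
      then have "delta \<kappa> [f x, g x] = 0"
        using delta_eq_0[OF \<kappa>, of "[f x, g x]" "\<phi> c"] by (simp add: 0)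
      then show ?thesis by (simp add: x(1))
    qed
    then show ?thesis by (simp add: 0 pull_cochain_def fun_eq_iff)
  next
    case (Suc j)
    have ge: "1 \<le> \<pi> i" for i using e by (simp add: exponents_def)
    have "\<kappa> \<in> AL_space (\<pi> (Suc j)) l' R' S' (Suc j)"
      using \<kappa> by (simp add: AL_cocycles_iff Suc)
    from homotopy_in_AL_space[OF ge this]
    have H: "homotopy j \<kappa> \<in> AL_space (\<pi> (Suc j)) l R S j" .
    \<comment> \<open>The homotopy inherits the exponent of degree \<open>Suc j\<close>;
      \<open>nonincreasing_at\<close> makes the norm finite for the exponent of degree
      \<open>j\<close> as well.\<close>
    have "packing_norm (\<pi> j) l R S j (homotopy j \<kappa>) < \<infinity>"
      by (rule packing_norm_antimono_exponent[OF ge, of "Suc j"])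
        (use ni H in \<open>simp_all add: nonincreasing_at_def Suc AL_space_def\<close>)
    then have "homotopy j \<kappa> \<in> AL_space (\<pi> j) l R S j"
      using H by (simp add: AL_space_def)
    moreover have d: "coboundary S j (homotopy j \<kappa>) = ?d"
      using coboundary_homotopy \<kappa> by (simp add: Suc)
    moreover have "?d \<in> AL_space (\<pi> k) l R S k"
      using AL_cocycles_add[OF e _ AL_cocycles_scale[OF e f.pull_in_AL_cocycles[OF \<kappa>], of "-1"],
          OF g.pull_in_AL_cocycles[OF \<kappa>]]
      by (simp add: AL_cocycles_iff)
    ultimately have "homotopy j \<kappa> \<in> AL_complex \<pi> l R S j"
      by (simp add: AL_complex_def Suc)
    then have "coboundary S j (homotopy j \<kappa>) \<in> coboundary S j ` AL_complex \<pi> l R S j"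
      by (rule imageI)
    then show ?thesis unfolding d by (simp add: Suc)
  qed
  then show ?thesis
    by (rule cohomologousI[OF g.pull_in_AL_cocycles[OF \<kappa>] f.pull_in_AL_cocycles[OF \<kappa>]]) simp
qed

lemma pull_class_eq_pull_class:
  assumes e: "exponents \<pi>" and ni: "nonincreasing_at \<pi> k"
    and A: "A \<in> packing_cohomology \<pi> l' R' S' k"
  shows "pull_class f \<pi> l R S k A = pull_class g \<pi> l R S k A"
proof -
  obtain \<kappa> where \<kappa>: "\<kappa> \<in> AL_cocycles \<pi> l' R' S' k" "A = cohomologous \<pi> l' R' S' k `` {\<kappa>}"
    using A by (rule packing_cohomologyE)
  show ?thesis
    using equiv_class_eq[OF equiv_cohomologous[OF e] pull_cohomologous_pull[OF e ni \<kappa>(1)]]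
    by (simp add: \<kappa>(2) f.pull_class_eq[OF e \<kappa>(1)] g.pull_class_eq[OF e \<kappa>(1)])
qed

end

section \<open>Coarse embeddings and the choice of constants\<close>

lemma coarse_embedding_at_bounded_distance:
  assumes f: "coarse_embedding f" and D: "\<And>x. dist (f x) (g x) \<le> D"
  shows "coarse_embedding g"
  unfolding coarse_embedding_def
proof (intro allI impI)
  fix T :: real assume T: "0 < T"
  have "0 \<le> D" using D[of undefined] zero_le_dist order_trans by blast
  obtain T1 where T1: "T1 > 0" "\<And>x. \<exists>y. f ` ball x T \<subseteq> ball y T1"
    using f T unfolding coarse_embedding_def by meson
  \<comment> \<open>If \<open>g z\<close> is within \<open>T\<close> of \<open>y\<close>, then
    \<open>f z\<close> is within \<open>T + D\<close>, so preimages under \<open>g\<close> are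
    controlled by preimages of larger balls under \<open>f\<close>.\<close>
  obtain T2 where T2: "T2 > 0" "\<And>y. \<exists>x. f -` ball y (T + D) \<subseteq> ball x T2"
    using f T \<open>0 \<le> D\<close> unfolding coarse_embedding_def by (meson add_pos_nonneg)
  have "\<exists>y. g ` ball x T \<subseteq> ball y (T1 + D + T2)" for x
  proof -
    obtain y where y: "f ` ball x T \<subseteq> ball y T1" using T1(2) by blast
    have "dist y (g z) < T1 + D + T2" if "z \<in> ball x T" for z
    proof -
      have "dist y (f z) < T1" using y that by (simp add: image_subset_iff)
      then show ?thesis using dist_triangle[of y "g z" "f z"] D[of z] T2(1) by linarith
    qed
    then show ?thesis by (intro exI[of _ y]) auto
  qed
  moreover have "\<exists>x. g -` ball y T \<subseteq> ball x (T1 + D + T2)" for y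
  proof -
    obtain x where x: "f -` ball y (T + D) \<subseteq> ball x T2" using T2(2) by blast
    have "z \<in> ball x (T1 + D + T2)" if "g z \<in> ball y T" for z
    proof -
      have "dist y (f z) < T + D"
        using that dist_triangle[of y "f z" "g z"] D[of z] by (simp add: dist_commute)
      then have "z \<in> ball x T2" using x by auto
      then show ?thesis using T1(1) \<open>0 \<le> D\<close> by simp
    qed
    then show ?thesis by blast
  qed
  ultimately show "\<exists>T'>0. (\<forall>x. \<exists>y. g ` ball x T \<subseteq> ball y T') \<and> (\<forall>y. \<exists>x. g -` ball y T \<subseteq> ball x T')"
    using T1(1) T2(1) \<open>0 \<le> D\<close> by (intro exI[of _ "T1 + D + T2"]) auto
qed

lemma controlled_pair_exists:
  fixes f g :: "'a::metric_space \<Rightarrow> 'b::metric_space"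
  assumes f: "coarse_embedding f" and D: "\<And>x. dist (f x) (g x) \<le> D"
    and R: "0 < R" "R \<le> S" and l': "1 \<le> l'"
  obtains \<phi> R' l where "0 < R'" "1 \<le> l" "controlled_pair f g \<phi> l' R' R' l R S"
proof -
  have "0 \<le> D" using D[of undefined] zero_le_dist order_trans by blast
  have "0 < S" using R by simp
  obtain T where T: "T > 0" "\<And>x. \<exists>y. f ` ball x S \<subseteq> ball y T"
    using f \<open>0 < S\<close> unfolding coarse_embedding_def by meson
  then obtain \<phi> where \<phi>: "\<And>x. f ` ball x S \<subseteq> ball (\<phi> x) T" by metis
  define R' where "R' = T + D"
  have R': "0 < R'" using T(1) \<open>0 \<le> D\<close> by (simp add: R'_def)
  have fR': "f ` ball x S \<subseteq> ball (\<phi> x) R'" for x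
    using \<phi>[of x] subset_ball[of T R' "\<phi> x"] \<open>0 \<le> D\<close> by (auto simp: R'_def)
  have gR': "g ` ball x S \<subseteq> ball (\<phi> x) R'" for x
  proof (rule image_subsetI)
    fix z assume "z \<in> ball x S"
    then have "dist (\<phi> x) (f z) < T" using \<phi>[of x] by (simp add: image_subset_iff)
    then show "g z \<in> ball (\<phi> x) R'"
      using dist_triangle[of "\<phi> x" "g z" "f z"] D[of z] by (simp add: R'_def)
  qed
  \<comment> \<open>If two dilated target balls meet, then \<open>f c\<close> and
    \<open>f c'\<close> are joined through \<open>\<phi> c\<close>, a common point and
    \<open>\<phi> c'\<close>: two steps shorter than \<open>R'\<close> and two shorter than
    \<open>l' * R'\<close>.\<close>
  define U where "U = 2 * l' * R' + 2 * R'"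
  have "0 < U" using R' l' by (simp add: U_def add_nonneg_pos)
  obtain T2 where T2: "T2 > 0" "\<And>y. \<exists>x. f -` ball y U \<subseteq> ball x T2"
    using f \<open>0 < U\<close> unfolding coarse_embedding_def by meson
  \<comment> \<open>Points in a common ball of radius \<open>T2\<close> are less than
    \<open>2 * T2\<close> apart, and \<open>l * R = R + 2 * T2\<close> exceeds this; the summand 1
    gives \<open>1 \<le> l\<close>.\<close>
  define l where "l = 1 + 2 * T2 / R"
  have l: "1 \<le> l" using T2(1) R(1) by (simp add: l_def)
  have lR: "2 * T2 \<le> l * R" using R(1) by (simp add: l_def distrib_right)
  have near: "dist c c' < l * R" if nd: "\<not> disjnt (ball (\<phi> c) (l' * R')) (ball (\<phi> c') (l' * R'))" for c c'
  proof -
    obtain z where "dist (\<phi> c) z < l' * R'" "dist (\<phi> c') z < l' * R'"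
      using nd by (auto simp: disjnt_iff)
    moreover have "dist (\<phi> c) (f c) < R'" "dist (\<phi> c') (f c') < R'"
      using fR'[of c] fR'[of c'] \<open>0 < S\<close> by (simp_all add: image_subset_iff)
    ultimately have "dist (f c) (f c') < U"
      using dist_triangle[of "f c" "f c'" "\<phi> c"] dist_triangle[of "\<phi> c" "f c'" z]
        dist_triangle[of z "f c'" "\<phi> c'"]
      by (simp add: U_def dist_commute)
    moreover obtain x where "f -` ball (f c) U \<subseteq> ball x T2" using T2(2) by blast
    ultimately have "dist x c < T2" "dist x c' < T2" using \<open>0 < U\<close> by (simp_all add: subset_iff)
    then show ?thesis
      using dist_triangle[of c c' x] lR by (simp add: dist_commute)
  qed
  have "packing_map \<phi> l' R' R' l R S"
    unfolding packing_map_def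
  proof (intro ballI)
    fix P :: "('a \<times> real) set" assume P: "P \<in> packings l R S"
    let ?h = "\<lambda>(c, r :: real). (\<phi> c, R')"
    \<comment> \<open>Otherwise \<open>c'\<close> would lie in both dilated source balls, since
      \<open>l * R \<le> l * r\<close> for every radius \<open>r\<close> occurring in the
      packing.\<close>
    have disj: "disjnt (ball (\<phi> c) (l' * R')) (ball (\<phi> c') (l' * R'))"
      if cr: "(c, r) \<in> P" "(c', r') \<in> P" "(c, r) \<noteq> (c', r')" for c r c' r'
    proof (rule ccontr)
      assume "\<not> ?thesis"
      then have "dist c c' < l * R" by (rule near)
      also have "l * R \<le> l * r"
        using packings_radius[OF P cr(1)] l by (intro mult_left_mono) auto
      finally have "c' \<in> ball c (l * r)" by simp
      moreover have "c' \<in> ball c' (l * r')"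
        using packings_radius[OF P cr(2)] l R(1) by simp
      moreover have "disjnt (ball c (l * r)) (ball c' (l * r'))"
        using P cr unfolding packings_def pairwise_def by blast
      ultimately show False by (auto simp: disjnt_iff)
    qed
    have "0 < l' * R'" using l' R' by simp
    then have ne: "\<phi> c \<in> ball (\<phi> c) (l' * R')" for c by simp
    \<comment> \<open>Nonempty balls about the same point cannot be disjoint, so equal images force
      equal members of \<open>P\<close>.\<close>
    have "inj_on ?h P"
    proof (rule inj_onI, clarify)
      fix c r c' r' assume "(c, r) \<in> P" "(c', r') \<in> P" "\<phi> c = \<phi> c'"
      then show "c = c' \<and> r = r'"
        using disj[of c r c' r'] ne[of c] by (auto simp: disjnt_iff)
    qed
    moreover have "?h ` P \<in> packings l' R' R'"
      using disj by (auto simp: packings_def pairwise_def)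
    ultimately show "inj_on ?h P \<and> ?h ` P \<in> packings l' R' R'" by blast
  qed
  then have "controlled_pair f g \<phi> l' R' R' l R S"
    using fR' gR' by (simp add: controlled_pair_def controlled_map_def)
  then show ?thesis using that R' l by blast
qed

theorem proposition4:
  fixes \<pi> :: "nat \<Rightarrow> ennreal" and f :: "'a::metric_space \<Rightarrow> 'b::metric_space"
  assumes "exponents \<pi>" and "coarse_embedding f"
  shows
    "(\<forall>R S l'. 0 < R \<longrightarrow> R \<le> S \<longrightarrow> 1 \<le> l' \<longrightarrow>
        (\<exists>R' S' l. 0 < R' \<and> R' \<le> S' \<and> 1 \<le> l \<and>
           induces_morphism f \<pi> l' R' S' l R S \<and> is_multiplicative f \<pi> l' R' S' l R S)) \<and>
     (\<forall>g. bdd_above (range (\<lambda>x. dist (f x) (g x))) \<longrightarrow>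
        coarse_embedding g \<and>
        (\<forall>R S l'. 0 < R \<longrightarrow> R \<le> S \<longrightarrow> 1 \<le> l' \<longrightarrow>
           (\<exists>R' S' l. 0 < R' \<and> R' \<le> S' \<and> 1 \<le> l \<and>
              induces_morphism f \<pi> l' R' S' l R S \<and> is_multiplicative f \<pi> l' R' S' l R S \<and>
              induces_morphism g \<pi> l' R' S' l R S \<and> is_multiplicative g \<pi> l' R' S' l R S \<and>
              (\<forall>k. nonincreasing_at \<pi> k \<longrightarrow>
                 (\<forall>A \<in> packing_cohomology \<pi> l' R' S' k.
                    pull_class f \<pi> l R S k A = pull_class g \<pi> l R S k A)))))"
proof -
  \<comment> \<open>Comparing the two induced maps requires the same source and target spaces, so
    one choice of constants, made from the bound \<open>D\<close>, serves \<open>f\<close> and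
    \<open>g\<close> together.\<close>
  have main: "\<exists>R' S' l. 0 < R' \<and> R' \<le> S' \<and> 1 \<le> l \<and>
      induces_morphism f \<pi> l' R' S' l R S \<and> is_multiplicative f \<pi> l' R' S' l R S \<and>
      induces_morphism g \<pi> l' R' S' l R S \<and> is_multiplicative g \<pi> l' R' S' l R S \<and>
      (\<forall>k. nonincreasing_at \<pi> k \<longrightarrow> (\<forall>A \<in> packing_cohomology \<pi> l' R' S' k.
         pull_class f \<pi> l R S k A = pull_class g \<pi> l R S k A))"
    if D: "\<And>x. dist (f x) (g x) \<le> D" and R: "0 < R" "R \<le> S" "1 \<le> l'" for g D R S l'
  proof -
    obtain \<phi> R' l where "0 < R'" "1 \<le> l" and pair: "controlled_pair f g \<phi> l' R' R' l R S"
      using controlled_pair_exists[OF assms(2) D R] by blast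
    then interpret controlled_pair f g \<phi> l' R' R' l R S by simp
    show ?thesis
      using \<open>0 < R'\<close> \<open>1 \<le> l\<close> f.induces_morphism g.induces_morphism f.is_multiplicative
        g.is_multiplicative pull_class_eq_pull_class assms(1)
      by (intro exI[of _ R'] exI[of _ l]) blast
  qed
  show ?thesis
  proof (intro conjI allI impI)
    fix R S l' :: real assume "0 < R" "R \<le> S" "1 \<le> l'"
    \<comment> \<open>This is the case \<open>g = f\<close>, at distance 0.\<close>
    then show "\<exists>R' S' l. 0 < R' \<and> R' \<le> S' \<and> 1 \<le> l \<and>
        induces_morphism f \<pi> l' R' S' l R S \<and> is_multiplicative f \<pi> l' R' S' l R S"
      using main[of f 0 R S l'] by auto
  next
    fix g assume "bdd_above (range (\<lambda>x. dist (f x) (g x)))"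
    then obtain D where D: "\<And>x. dist (f x) (g x) \<le> D" by (auto simp: bdd_above_def)
    then show "coarse_embedding g"
      using coarse_embedding_at_bounded_distance[OF assms(2)] by blast
    fix R S l' :: real assume "0 < R" "R \<le> S" "1 \<le> l'"
    then show "\<exists>R' S' l. 0 < R' \<and> R' \<le> S' \<and> 1 \<le> l \<and>
        induces_morphism f \<pi> l' R' S' l R S \<and> is_multiplicative f \<pi> l' R' S' l R S \<and>
        induces_morphism g \<pi> l' R' S' l R S \<and> is_multiplicative g \<pi> l' R' S' l R S \<and>
        (\<forall>k. nonincreasing_at \<pi> k \<longrightarrow> (\<forall>A \<in> packing_cohomology \<pi> l' R' S' k.
           pull_class f \<pi> l R S k A = pull_class g \<pi> l R S k A))"
      using main[OF D] by blast
  qed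
qed

end
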